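(* $\mathbb{A}_+(1)=\mathbb{A}_+^{\mathcal B}(1)=\mathbb{A}_+^{\mathcal S}(1)$.
   Context: Fourier transform on $\mathbb{R}^d$: $\widehat f(\xi)=\int_{\mathbb{R}^d} f(x)e^{-2\pi i\langle x,\xi\rangle}\,dx$. A function $f:\mathbb{R}^d\to\mathbb{R}$ is eventually nonnegative if $f(x)\ge 0$ for all sufficiently large $|x|$. For $f:\mathbb{R}^d\to\mathbb{R}$ let $r(f):=\inf\{r>0: f(x)\ge 0 \text{ for all } |x|\ge r\}$. $\mathcal A_+(d)$ is the set of $f:\mathbb{R}^d\to\mathbb{R}$ such that: $f\in L^1(\mathbb{R}^d)$, $\widehat f\in L^1(\mathbb{R}^d)$ and $\widehat f$ is real-valued (i.e. $f$ is even); $f$ is eventually nonnegative and $\widehat f(0)\le 0$; $\widehat f$ is eventually nonnegative and $f(0)\le 0$. Define $\mathbb{A}_+(d):=\inf\{\sqrt{r(f)r(\widehat f)}: f\in\mathcal A_+(d)\setminus\{0\}\}$. A function is bandlimited if its distributional Fourier transform has compact support. $\mathbb{A}_+^{\mathcal B}(d)$ is the same infimum restricted to bandlimited nonzero $f\in\mathcal A_+(d)$, and $\mathbb{A}_+^{\mathcal S}(d)$ is the same infimum restricted to nonzero $f\in\mathcal A_+(d)\cap\mathcal S(\mathbb{R}^d)$ (Schwartz class). *)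

theory Defs
  imports "HOL-Analysis.Analysis"
begin

definition fourier :: "(real \<Rightarrow> real) \<Rightarrow> real \<Rightarrow> complex" where
  "fourier f \<xi> = integral\<^sup>L lborel (\<lambda>x. complex_of_real (f x) * cis (- 2 * pi * x * \<xi>))"

definition fourier_re :: "(real \<Rightarrow> real) \<Rightarrow> real \<Rightarrow> real" where
  "fourier_re f = (\<lambda>\<xi>. Re (fourier f \<xi>))"

definition eventually_nonneg :: "(real \<Rightarrow> real) \<Rightarrow> bool" where
  "eventually_nonneg f \<longleftrightarrow> (\<exists>r. \<forall>x. \<bar>x\<bar> \<ge> r \<longrightarrow> f x \<ge> 0)"

definition sign_radius :: "(real \<Rightarrow> real) \<Rightarrow> real" where
  "sign_radius f = Inf {r. r > 0 \<and> (\<forall>x. \<bar>x\<bar> \<ge> r \<longrightarrow> f x \<ge> 0)}"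

text \<open>The class A_+(1). f is taken to be continuous (the canonical representative,
  since f is the inverse Fourier transform of an L^1 function).\<close>
definition A_plus :: "(real \<Rightarrow> real) set" where
  "A_plus = {f. continuous_on UNIV f \<and> integrable lborel f
      \<and> (\<forall>\<xi>. Im (fourier f \<xi>) = 0) \<and> integrable lborel (fourier_re f)
      \<and> eventually_nonneg f \<and> fourier_re f 0 \<le> 0
      \<and> eventually_nonneg (fourier_re f) \<and> f 0 \<le> 0}"

text \<open>Bandlimited: the Fourier transform (here an honest continuous function, as f is in L^1)
  has compact support.\<close>
definition bandlimited :: "(real \<Rightarrow> real) \<Rightarrow> bool" where
  "bandlimited f \<longleftrightarrow> compact (closure {\<xi>. fourier f \<xi> \<noteq> 0})"

definition schwartz :: "(real \<Rightarrow> real) \<Rightarrow> bool" where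
  "schwartz f \<longleftrightarrow>
     (\<forall>n x. ((deriv ^^ n) f has_real_derivative (deriv ^^ Suc n) f x) (at x))
     \<and> (\<forall>m n. bounded (range (\<lambda>x. x ^ m * (deriv ^^ n) f x)))"

definition A_plus_const :: "((real \<Rightarrow> real) \<Rightarrow> bool) \<Rightarrow> real" where
  "A_plus_const P = Inf {sqrt (sign_radius f * sign_radius (fourier_re f)) | f.
       f \<in> A_plus \<and> f \<noteq> (\<lambda>_. 0) \<and> P f}"

end

theory Submission
  imports Defs "HOL-Probability.Probability" "HOL-Complex_Analysis.Cauchy_Integral_Formula"
begin

text \<open>
  Let f be a nonzero admissible function whose product of sign radii is less than v^2. After a
  dilation, adding the Fourier transform gives a self-dual F that is nonnegative outside a radius
  less than v, with F(0) \<le> 0, and F does not vanish near infinity, since otherwise F and its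
  transform would both have compact support. The point is to make F(0) strictly negative, for then
  the usual regularisations by convolution and multiplication are harmless.

  Summing dilates of F by factors close to 1 keeps all properties and makes F positive on an interval
  around some large X whose length w is a fixed proportion of X. Let \<tau> be an even pair of tents on
  this interval and its mirror image. Its transform is 2w at the origin but only O(1/w) outside
  a fixed neighbourhood of it. Hence, for a small multiple of the self-dual function
  - \<tau> - \<tau>^ + (C/w) h, where h is positive, self-dual and of order 1/x^2, adding it to F makes the
  value at 0 negative, the tents being absorbed by the positivity of F and \<tau>^ by h. The result
  even has a lower bound of order 1/x^2 outside the radius, which absorbs the tails of the Fejer
  kernel (whose transform has compact support) and of the Gaussian.
\<close>

section \<open>Integrals and approximate identities\<close>

text \<open>A value F(0) = 0 can turn positive under smoothing, and where F touches zero outside its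
  radius the kernel tails can let the negative values near the origin prevail. Strict negativity at
  0 cures the first, a quantitative lower bound outside the radius the second. The correction that
  produces both must be self-dual, or else it would repair one side of the Fourier transform and
  damage the other. Its gain at 0 is 2w and its cost is of order 1/w, so it wins only for large w.
  Hence F must be positive on a long interval, and for this f must be positive at arbitrarily large
  points; that is where the uncertainty principle for compact supports enters. Several steps enlarge
  the radius a little, which the strict inequality below v pays for. One convolution suffices for a
  bandlimited function. A Schwartz function needs a Gaussian convolution for smoothness and a
  Gaussian factor for decay; the factor is a second convolution on the transform side, acting on a
  function whose lower bound is only Gaussian, so it needs its own positivity argument.\<close>

lemma borel_measurable_cis [measurable]: "cis \<in> borel_measurable borel"
  by (intro borel_measurable_continuous_onI continuous_intros)

lemma integrable_mult_cis:
  assumes "integrable lborel f" and [measurable]: "g \<in> borel_measurable borel"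
  shows "integrable lborel (\<lambda>x. complex_of_real (f x) * cis (g x))"
  by (rule Bochner_Integration.integrable_bound[OF assms(1)])
     (use assms in \<open>auto simp: norm_mult\<close>)

lemma fourier_add:
  assumes "integrable lborel f" "integrable lborel g"
  shows "fourier (\<lambda>x. f x + g x) \<xi> = fourier f \<xi> + fourier g \<xi>"
  unfolding fourier_def using assms
  by (simp add: distrib_right integrable_mult_cis)

lemma fourier_cmult: "fourier (\<lambda>x. c * f x) \<xi> = complex_of_real c * fourier f \<xi>"
  unfolding fourier_def by (simp add: mult.assoc)

lemma norm_fourier_le: "norm (fourier f \<xi>) \<le> (\<integral>x. \<bar>f x\<bar> \<partial>lborel)"
proof -
  have "norm (fourier f \<xi>) \<le> (\<integral>x. norm (complex_of_real (f x) * cis (- 2 * pi * x * \<xi>)) \<partial>lborel)"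
    unfolding fourier_def by (rule integral_norm_bound)
  then show ?thesis by (simp add: norm_mult)
qed

lemma fourier_uminus: "fourier f (-\<xi>) = cnj (fourier f \<xi>)"
  unfolding fourier_def by (simp flip: Bochner_Integration.integral_cnj add: cis_cnj)

lemma continuous_fourier:
  assumes "integrable lborel f"
  shows "continuous_on UNIV (fourier f)"
proof -
  have "(\<lambda>n. fourier f (s n)) \<longlonglongrightarrow> fourier f \<xi>" if s: "s \<longlonglongrightarrow> \<xi>" for s \<xi>
    unfolding fourier_def
  proof (rule integral_dominated_convergence[where w = "\<lambda>x. \<bar>f x\<bar>"])
    show "AE x in lborel. (\<lambda>n. complex_of_real (f x) * cis (- 2 * pi * x * s n))
        \<longlonglongrightarrow> complex_of_real (f x) * cis (- 2 * pi * x * \<xi>)"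
      by (intro AE_I2 tendsto_intros s)
  qed (use assms in \<open>auto simp: norm_mult\<close>)
  then show ?thesis
    by (auto simp: continuous_on_sequentially o_def)
qed

section \<open>The Gaussian and its transform\<close>

lemma fourier_gaussian:
  assumes a: "a > 0"
  shows "fourier (\<lambda>x. exp (- pi * a\<^sup>2 * x\<^sup>2)) \<xi> = complex_of_real (exp (- pi * \<xi>\<^sup>2 / a\<^sup>2) / a)"
proof -
  \<comment> \<open>With this \<open>c\<close> the exponent (c x)^2 / 2 of the normal density
    becomes pi a^2 x^2, and \<open>t\<close> turns the phase of the characteristic function into - 2
    pi x \<xi>.\<close>
  define c where "c = sqrt (2 * pi) * a"
  define t where "t = - 2 * pi * \<xi> / c"
  have c: "c > 0" "c\<^sup>2 = 2 * pi * a\<^sup>2" using a by (auto simp: c_def power_mult_distrib)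
  have "char std_normal_distribution t = (CLINT x|lborel. std_normal_density x *\<^sub>R iexp (t * x))"
    unfolding char_def by (subst integral_density) auto
  also have "\<dots> = \<bar>c\<bar> *\<^sub>R (CLINT x|lborel. std_normal_density (0 + c * x) *\<^sub>R iexp (t * (0 + c * x)))"
    using c by (intro lborel_integral_real_affine) auto
  also have "(\<lambda>x. std_normal_density (0 + c * x) *\<^sub>R iexp (t * (0 + c * x)))
     = (\<lambda>x. complex_of_real (1 / sqrt (2 * pi)) * (complex_of_real (exp (- pi * a\<^sup>2 * x\<^sup>2)) * cis (- 2 * pi * x * \<xi>)))"
    using c(1) by (auto simp: fun_eq_iff normal_density_def power_mult_distrib c(2) t_def
        cis_conv_exp scaleR_conv_of_real field_simps)
  also have "\<bar>c\<bar> *\<^sub>R (CLINT x|lborel. (complex_of_real (1 / sqrt (2 * pi)) * (complex_of_real (exp (- pi * a\<^sup>2 * x\<^sup>2)) * cis (- 2 * pi * x * \<xi>))))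
     = a * fourier (\<lambda>x. exp (- pi * a\<^sup>2 * x\<^sup>2)) \<xi>"
    using c(1) a by (simp add: c_def fourier_def scaleR_conv_of_real)
  finally have "a * fourier (\<lambda>x. exp (- pi * a\<^sup>2 * x\<^sup>2)) \<xi> = exp (- (t\<^sup>2) / 2)"
    by (simp add: char_std_normal_distribution)
  moreover have "- (t\<^sup>2) / 2 = - pi * \<xi>\<^sup>2 / a\<^sup>2"
  proof -
    have "t\<^sup>2 = 4 * pi\<^sup>2 * \<xi>\<^sup>2 / (2 * pi * a\<^sup>2)"
      by (simp add: t_def power_divide power_mult_distrib c(2))
    then show ?thesis by (simp add: power2_eq_square field_simps)
  qed
  ultimately have "a * fourier (\<lambda>x. exp (- pi * a\<^sup>2 * x\<^sup>2)) \<xi> = complex_of_real (exp (- pi * \<xi>\<^sup>2 / a\<^sup>2))"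
    by (simp only:)
  then show ?thesis using a by (simp add: field_simps)
qed

lemma integrable_gaussian:
  assumes "a > 0"
  shows "integrable lborel (\<lambda>x::real. exp (- pi * a\<^sup>2 * x\<^sup>2))"
proof -
  define c where "c = sqrt (2 * pi) * a"
  have c: "c > 0" "c\<^sup>2 = 2 * pi * a\<^sup>2" using assms by (auto simp: c_def power_mult_distrib)
  have "integrable lborel (\<lambda>x. sqrt (2*pi) * std_normal_density (0 + c * x))"
    using c by (intro integrable_mult_right lborel_integrable_real_affine) auto
  also have "(\<lambda>x. sqrt (2*pi) * std_normal_density (0 + c * x)) = (\<lambda>x. exp (- pi * a\<^sup>2 * x\<^sup>2))"
    by (auto simp: normal_density_def power_mult_distrib c(2))
  finally show ?thesis .
qed

text \<open>Supplies the Fubini exchanges that compute transforms in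
  \<open>fourier_inversion\<close> and \<open>fourier_pair_conv\<close>, where the integrand is a
  product of two integrable functions and a unimodular phase.\<close>

lemma integrable_lborel_pair_bound:
  fixes h :: "real \<times> real \<Rightarrow> 'b::{banach, second_countable_topology}"
  assumes f: "integrable lborel f" and g: "integrable lborel g"
    and [measurable]: "h \<in> borel_measurable (lborel \<Otimes>\<^sub>M lborel)"
    and le: "\<And>x y. norm (h (x, y)) \<le> \<bar>f x :: real\<bar> * \<bar>g y :: real\<bar>"
  shows "integrable (lborel \<Otimes>\<^sub>M lborel) h"
proof -
  have [measurable]: "f \<in> borel_measurable borel" "g \<in> borel_measurable borel"
    using f g by auto
  have "integrable (lborel \<Otimes>\<^sub>M lborel) (\<lambda>(x, y). f x * g y)"
    by (rule lborel_pair.Fubini_integrable) (use f g in \<open>auto simp: abs_mult\<close>)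
  then show ?thesis
    by (rule Bochner_Integration.integrable_bound) (auto simp: le abs_mult)
qed

lemma integrable_inverse_1_plus_square_lborel:
  "integrable lborel (\<lambda>x::real. 1 / (1 + x\<^sup>2))"
  using integrable_inverse_1_plus_square
  by (simp add: set_integrable_def einterval_def inverse_eq_divide)

text \<open>Away from the origin the singular 1/x^2 is traded for the integrable 1 / (1 + x^2). The
  constant returns as \<open>E\<close> in \<open>self_dual_strictify\<close>.\<close>

lemma inverse_square_le:
  fixes x :: real
  assumes "t > 0" "t \<le> \<bar>x\<bar>"
  shows "1 / x\<^sup>2 \<le> (1 + 1 / t\<^sup>2) / (1 + x\<^sup>2)"
proof -
  have t2: "t\<^sup>2 \<le> x\<^sup>2" and p: "x\<^sup>2 > 0"
    using assms by (auto simp: abs_le_square_iff[symmetric])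
  have "1 + x\<^sup>2 \<le> (1 + 1 / t\<^sup>2) * x\<^sup>2"
    using t2 assms by (simp add: distrib_right)
  then show ?thesis using p by (simp add: pos_divide_le_eq pos_le_divide_eq add_pos_nonneg)
qed

lemma integral_lincomb3:
  fixes p q r :: "real \<Rightarrow> real"
  assumes "integrable lborel p" "integrable lborel q" "integrable lborel r"
  shows "(\<integral>x. a * p x + b * q x + c * r x \<partial>lborel)
    = a * integral\<^sup>L lborel p + b * integral\<^sup>L lborel q + c * integral\<^sup>L lborel r"
  using assms by simp

text \<open>The common interface of the Fejer kernel and the Gaussian. The bound \<open>M\<close>
  keeps products with integrable functions integrable; the inverse-square decay is what is later
  matched against a lower bound c / (1 + x^2).\<close>

locale kernel =
  fixes K :: "real \<Rightarrow> real" and M C :: real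
  assumes continuous: "continuous_on UNIV K"
    and integrable: "integrable lborel K"
    and nonneg: "0 \<le> K x"
    and le_M: "K x \<le> M"
    and decay: "K x * x\<^sup>2 \<le> C"
    and integral_1: "(\<integral>x. K x \<partial>lborel) = 1"
begin

lemma measurable_K [measurable]: "K \<in> borel_measurable borel"
  using continuous by (rule borel_measurable_continuous_onI)

lemma C_nonneg: "0 \<le> C"
  using decay[of 0] by simp

lemma scaled_integrable:
  assumes "d > 0"
  shows "integrable lborel (\<lambda>y. K ((x - y) / d) / d)"
  using lborel_integrable_real_affine[OF integrable, of "- 1 / d" "x / d"] assms
  by (simp add: diff_divide_distrib)

lemma scaled_integral:
  assumes "d > 0"
  shows "(\<integral>y. K ((x - y) / d) / d \<partial>lborel) = 1"
  using lborel_integral_real_affine[of "- 1 / d" K "x / d"] assms integral_1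
  by (simp add: diff_divide_distrib)

lemma scaled_le:
  assumes "d > 0" "t > 0" "t \<le> \<bar>y\<bar>"
  shows "K (y / d) / d \<le> C * d / t\<^sup>2"
proof -
  have "K (y / d) / d * t\<^sup>2 \<le> K (y / d) / d * y\<^sup>2"
    using assms nonneg by (intro mult_left_mono) (auto simp: abs_le_square_iff[symmetric])
  also have "\<dots> = K (y / d) * (y / d)\<^sup>2 * d"
    using assms by (simp add: power2_eq_square field_simps)
  also have "\<dots> \<le> C * d"
    using decay assms by (intro mult_right_mono) auto
  finally show ?thesis using assms by (simp add: field_simps)
qed

lemma mult_integrable:
  assumes "integrable lborel f" "d > 0"
  shows "integrable lborel (\<lambda>y. f y * (K ((x - y) / d) / d))"
proof (rule Bochner_Integration.integrable_bound)
  show "integrable lborel (\<lambda>y. (M / d) * f y)"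
    using assms by simp
  show "AE y in lborel. norm (f y * (K ((x - y) / d) / d)) \<le> norm (M / d * f y)"
  proof (intro AE_I2)
    fix y
    define k where "k = K ((x - y) / d) / d"
    have "0 \<le> k" "k \<le> M / d"
      using assms le_M nonneg by (auto simp: k_def divide_right_mono)
    then have "\<bar>f y\<bar> * \<bar>k\<bar> \<le> \<bar>f y\<bar> * \<bar>M / d\<bar>"
      by (intro mult_left_mono) linarith+
    then show "norm (f y * (K ((x - y) / d) / d)) \<le> norm (M / d * f y)"
      by (simp only: abs_mult real_norm_def k_def[symmetric] mult.commute)
  qed
qed (use assms in auto)

text \<open>Uniformity in x is the point: in \<open>conv_nonneg\<close> one \<open>d\<close> must
  serve all x. The majorant C d (1 + 1/t^2) / (1 + (x - y)^2) has an integral that is independent of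
  x by translation and linear in d.\<close>

lemma tail:
  assumes "e > 0" "t > 0"
  shows "\<forall>\<^sub>F d in at_right 0. \<forall>x. (\<integral>y. indicator {y. t \<le> \<bar>x - y\<bar>} y * (K ((x - y) / d) / d) \<partial>lborel) \<le> e"
proof -
  define I where "I = (\<integral>x. 1 / (1 + x\<^sup>2) \<partial>lborel :: real)"
  define B where "B = C * (1 + 1 / t\<^sup>2) * I"
  have "((\<lambda>d. d * B) \<longlongrightarrow> 0 * B) (at_right 0)"
    by (intro tendsto_intros)
  then have "\<forall>\<^sub>F d in at_right 0. d * B < e"
    using assms by (intro order_tendstoD) auto
  moreover have "\<forall>\<^sub>F d in at_right (0::real). d > 0"
    by (auto simp: eventually_at_filter)
  ultimately show ?thesis
  proof eventually_elim
    case (elim d)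
    show ?case
    proof
      fix x
      have int: "integrable lborel (\<lambda>y. C * d * (1 + 1 / t\<^sup>2) * (1 / (1 + (x - y)\<^sup>2)))"
        using lborel_integrable_real_affine[OF integrable_inverse_1_plus_square_lborel, of "-1" x]
        by (intro integrable_mult_right) simp
      have "(\<integral>y. indicator {y. t \<le> \<bar>x - y\<bar>} y * (K ((x - y) / d) / d) \<partial>lborel)
          \<le> (\<integral>y. C * d * (1 + 1 / t\<^sup>2) * (1 / (1 + (x - y)\<^sup>2)) \<partial>lborel)"
      proof (rule integral_mono[OF _ int])
        show "integrable lborel (\<lambda>y. indicator {y. t \<le> \<bar>x - y\<bar>} y * (K ((x - y) / d) / d))"
          by (rule Bochner_Integration.integrable_bound[OF scaled_integrable[OF \<open>d > 0\<close>, of x]])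
             (auto simp: indicator_def)
        fix y
        show "indicator {y. t \<le> \<bar>x - y\<bar>} y * (K ((x - y) / d) / d)
            \<le> C * d * (1 + 1 / t\<^sup>2) * (1 / (1 + (x - y)\<^sup>2))"
        proof (cases "t \<le> \<bar>x - y\<bar>")
          case True
          have "K ((x - y) / d) / d \<le> C * d / (\<bar>x - y\<bar>)\<^sup>2"
            using elim True assms by (intro scaled_le) auto
          also have "\<dots> = C * d * (1 / (x - y)\<^sup>2)" by simp
          also have "\<dots> \<le> C * d * ((1 + 1 / t\<^sup>2) * (1 / (1 + (x - y)\<^sup>2)))"
            using inverse_square_le[OF \<open>t > 0\<close> True] C_nonneg elim by (intro mult_left_mono) auto
          finally show ?thesis using True by simp
        next
          case False
          then show ?thesis using C_nonneg elim by simp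
        qed
      qed
      also have "\<dots> = C * d * (1 + 1 / t\<^sup>2) * I"
        using lborel_integral_real_affine[of "-1" "\<lambda>y. 1 / (1 + y\<^sup>2)" x]
        unfolding I_def integral_mult_right_zero by simp
      also have "\<dots> = d * B" by (simp add: B_def)
      finally show "(\<integral>y. indicator {y. t \<le> \<bar>x - y\<bar>} y * (K ((x - y) / d) / d) \<partial>lborel) \<le> e"
        using elim by simp
    qed
  qed
qed

text \<open>Near x continuity applies. Far from x, the part with f(y) is at most the kernel bound C
  d / t^2 times the L1 norm of f, and the part with f(x) is small because the kernel has little mass
  there.\<close>

lemma conv_tendsto:
  assumes f: "integrable lborel f" and cont: "isCont f x"
  shows "((\<lambda>d. \<integral>y. f y * (K ((x - y) / d) / d) \<partial>lborel) \<longlongrightarrow> f x) (at_right 0)"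
proof (rule tendstoI)
  fix e :: real assume e: "e > 0"
  define N where "N = (\<integral>y. \<bar>f y\<bar> \<partial>lborel)"
  have N: "N \<ge> 0" by (simp add: N_def)
  obtain t where t: "t > 0" "\<And>y. \<bar>y - x\<bar> < t \<Longrightarrow> \<bar>f y - f x\<bar> < e / 4"
    using cont e unfolding continuous_at_eps_delta dist_real_def
    by (metis zero_less_divide_iff zero_less_numeral)
  have "\<forall>\<^sub>F d in at_right (0::real). d > 0"
    by (auto simp: eventually_at_filter)
  moreover have "\<forall>\<^sub>F d in at_right 0. (\<integral>y. indicator {y. t \<le> \<bar>x - y\<bar>} y * (K ((x - y) / d) / d) \<partial>lborel) \<le> e / 4 / (1 + \<bar>f x\<bar>)"
    using tail[of "e / 4 / (1 + \<bar>f x\<bar>)" t] e t by (auto elim: eventually_mono)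
  moreover have "\<forall>\<^sub>F d in at_right 0. C * d / t\<^sup>2 * N < e / 4"
  proof -
    have "((\<lambda>d. C * d / t\<^sup>2 * N) \<longlongrightarrow> C * 0 / t\<^sup>2 * N) (at_right 0)"
      using t by (intro tendsto_intros) auto
    then show ?thesis using e by (intro order_tendstoD) auto
  qed
  ultimately show "\<forall>\<^sub>F d in at_right 0. dist (\<integral>y. f y * (K ((x - y) / d) / d) \<partial>lborel) (f x) < e"
  proof eventually_elim
    case (elim d)
    let ?K = "\<lambda>y. K ((x - y) / d) / d"
    let ?i = "\<lambda>y. indicator {y. t \<le> \<bar>x - y\<bar>} y * ?K y"
    have K0: "?K y \<ge> 0" for y using nonneg elim by simp
    have Ki: "integrable lborel ?K" using elim scaled_integrable by blast
    have ii: "integrable lborel ?i"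
      by (rule Bochner_Integration.integrable_bound[OF Ki]) (auto simp: indicator_def)
    have fK: "integrable lborel (\<lambda>y. f y * ?K y)" using f elim mult_integrable by blast
    have fxK: "integrable lborel (\<lambda>y. f x * ?K y)" by (rule integrable_mult_right) (rule Ki)
    have "(\<integral>y. f y * ?K y \<partial>lborel) - f x = (\<integral>y. f y * ?K y \<partial>lborel) - (\<integral>y. f x * ?K y \<partial>lborel)"
      using elim scaled_integral[of d x] by (simp only: integral_mult_right_zero)
    also have "\<dots> = (\<integral>y. f y * ?K y - f x * ?K y \<partial>lborel)"
      by (rule Bochner_Integration.integral_diff[OF fK fxK, symmetric])
    finally have "\<bar>(\<integral>y. f y * ?K y \<partial>lborel) - f x\<bar> = norm (\<integral>y. f y * ?K y - f x * ?K y \<partial>lborel)"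
      by simp
    also have "\<dots> \<le> (\<integral>y. e / 4 * ?K y + C * d / t\<^sup>2 * \<bar>f y\<bar> + \<bar>f x\<bar> * ?i y \<partial>lborel)"
    proof (rule Bochner_Integration.integral_norm_bound_integral)
      show "integrable lborel (\<lambda>y. f y * ?K y - f x * ?K y)" using fK fxK by (rule Bochner_Integration.integrable_diff)
      show "integrable lborel (\<lambda>y. e / 4 * ?K y + C * d / t\<^sup>2 * \<bar>f y\<bar> + \<bar>f x\<bar> * ?i y)"
        using Ki ii f by (intro Bochner_Integration.integrable_add integrable_mult_right) auto
      fix y
      show "norm (f y * ?K y - f x * ?K y) \<le> e / 4 * ?K y + C * d / t\<^sup>2 * \<bar>f y\<bar> + \<bar>f x\<bar> * ?i y"
      proof (cases "t \<le> \<bar>x - y\<bar>")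
        case True
        have "?K y \<le> C * d / t\<^sup>2" using True t elim by (intro scaled_le) auto
        then have 1: "\<bar>f y\<bar> * ?K y \<le> C * d / t\<^sup>2 * \<bar>f y\<bar>" by (subst mult.commute) (rule mult_right_mono, auto)
        have "norm (f y * ?K y - f x * ?K y) \<le> norm (f y * ?K y) + norm (f x * ?K y)"
          by (rule norm_triangle_ineq4)
        also have "\<dots> = \<bar>f y\<bar> * ?K y + \<bar>f x\<bar> * ?K y"
          using K0 by (simp only: norm_mult real_norm_def abs_mult abs_of_nonneg)
        also have "\<dots> \<le> e / 4 * ?K y + C * d / t\<^sup>2 * \<bar>f y\<bar> + \<bar>f x\<bar> * ?K y"
          using 1 mult_nonneg_nonneg[OF _ K0[of y], of "e / 4"] e by linarith
        finally show ?thesis using True by simp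
      next
        case False
        then have "\<bar>f y - f x\<bar> < e / 4" by (intro t(2)) linarith
        then have "\<bar>f y - f x\<bar> * ?K y \<le> e / 4 * ?K y" using K0 by (intro mult_right_mono) auto
        moreover have "norm (f y * ?K y - f x * ?K y) = \<bar>f y - f x\<bar> * ?K y"
          using K0 by (simp only: left_diff_distrib[symmetric] norm_mult real_norm_def abs_mult abs_of_nonneg)
        moreover have "0 \<le> C * d / t\<^sup>2 * \<bar>f y\<bar>" using C_nonneg elim by simp
        ultimately show ?thesis using False by simp
      qed
    qed
    also have "\<dots> = e / 4 * 1 + C * d / t\<^sup>2 * N + \<bar>f x\<bar> * (\<integral>y. ?i y \<partial>lborel)"
      using integral_lincomb3[OF Ki integrable_abs[OF f] ii] elim scaled_integral[of d x]
      by (simp only: N_def)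
    also have "\<bar>f x\<bar> * (\<integral>y. ?i y \<partial>lborel) \<le> \<bar>f x\<bar> * (e / 4 / (1 + \<bar>f x\<bar>))"
      using elim by (intro mult_left_mono) auto
    also have "\<dots> \<le> e / 4" using e by (simp add: divide_simps)
    finally show ?case using elim(3) e unfolding dist_real_def by linarith
  qed
qed

end

section \<open>Fourier inversion and Fourier pairs\<close>

lemma gaussian_kernel: "kernel (\<lambda>x. exp (- pi * x\<^sup>2)) 1 1"
proof
  show "integrable lborel (\<lambda>x::real. exp (- pi * x\<^sup>2))"
    using integrable_gaussian[of 1] by simp
  show "exp (- pi * x\<^sup>2) \<le> 1" for x :: real
    by simp
  show "exp (- pi * x\<^sup>2) * x\<^sup>2 \<le> 1" for x :: real
  proof -
    have "x\<^sup>2 \<le> pi * x\<^sup>2" using pi_gt3 by (simp add: mult_le_cancel_right1)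
    also have "\<dots> \<le> exp (pi * x\<^sup>2)" using exp_ge_add_one_self[of "pi * x\<^sup>2"] by linarith
    finally show ?thesis by (simp add: exp_minus field_simps)
  qed
  have "complex_of_real (\<integral>x. exp (- pi * x\<^sup>2) \<partial>lborel) = fourier (\<lambda>x. exp (- pi * 1\<^sup>2 * x\<^sup>2)) 0"
    by (simp add: fourier_def flip: integral_complex_of_real)
  also have "\<dots> = 1" by (subst fourier_gaussian) auto
  finally show "(\<integral>x. exp (- pi * x\<^sup>2) \<partial>lborel) = 1"
    using of_real_eq_1_iff by blast
qed (auto intro!: continuous_intros)

lemma filterlim_inverse_Suc_at_right_0:
  "filterlim (\<lambda>n. inverse (real (Suc n))) (at_right 0) sequentially"
  using LIMSEQ_inverse_real_of_nat by (auto simp: filterlim_at)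

text \<open>A Gaussian factor makes Fubini available: the damped inverse integral of g is the
  convolution of f with a Gaussian of width d. As d tends to 0, one side converges by dominated
  convergence, the other to f(x).\<close>

lemma fourier_inversion:
  assumes cont: "continuous_on UNIV f" and f: "integrable lborel f" and g: "integrable lborel g"
    and fg: "\<And>\<xi>. fourier f \<xi> = complex_of_real (g \<xi>)"
  shows "fourier g x = complex_of_real (f x)"
proof -
  let ?E = "\<lambda>d \<xi>. exp (- pi * d\<^sup>2 * \<xi>\<^sup>2) :: real"
  have [measurable]: "f \<in> borel_measurable borel" "g \<in> borel_measurable borel"
    using f g by auto
  have swap: "(CLINT \<xi>|lborel. complex_of_real (g \<xi>) * cis (2 * pi * x * \<xi>) * complex_of_real (?E d \<xi>))
     = complex_of_real (\<integral>y. f y * (exp (- pi * ((x - y) / d)\<^sup>2) / d) \<partial>lborel)" if d: "d > 0" for d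
  proof -
    define h where "h = (\<lambda>y \<xi>. complex_of_real (f y) * (complex_of_real (?E d \<xi>) * cis (- 2 * pi * \<xi> * (y - x))))"
    have h: "h y \<xi> = complex_of_real (f y) * cis (- 2 * pi * y * \<xi>) * (cis (2 * pi * x * \<xi>) * complex_of_real (?E d \<xi>))" for y \<xi>
    proof -
      have "cis (- 2 * pi * \<xi> * (y - x)) = cis (- 2 * pi * y * \<xi>) * cis (2 * pi * x * \<xi>)"
        by (simp add: cis_mult algebra_simps)
      then show ?thesis by (simp add: h_def)
    qed
    have "(CLINT \<xi>|lborel. complex_of_real (g \<xi>) * cis (2 * pi * x * \<xi>) * complex_of_real (?E d \<xi>))
       = (CLINT \<xi>|lborel. (CLINT y|lborel. h y \<xi>))"
      unfolding h integral_mult_left_zero fourier_def[symmetric] fg by (simp add: mult.assoc)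
    also have "\<dots> = (CLINT y|lborel. (CLINT \<xi>|lborel. h y \<xi>))"
    proof (rule lborel_pair.Fubini_integral)
      show "integrable (lborel \<Otimes>\<^sub>M lborel) (\<lambda>(y, \<xi>). h y \<xi>)"
        by (rule integrable_lborel_pair_bound[OF f integrable_gaussian[OF d]])
           (auto simp: h_def norm_mult)
    qed
    also have "(\<lambda>y. CLINT \<xi>|lborel. h y \<xi>) = (\<lambda>y. complex_of_real (f y) * fourier (?E d) (y - x))"
      by (simp add: h_def fourier_def)
    also have "\<dots> = (\<lambda>y. complex_of_real (f y * (exp (- pi * ((x - y) / d)\<^sup>2) / d)))"
      unfolding fourier_gaussian[OF d] by (auto simp: fun_eq_iff power_divide power2_commute)
    finally show ?thesis by (simp only: integral_complex_of_real)
  qed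
  let ?d = "\<lambda>n. inverse (real (Suc n))"
  have "(\<lambda>n. CLINT \<xi>|lborel. complex_of_real (g \<xi>) * cis (2 * pi * x * \<xi>) * complex_of_real (?E (?d n) \<xi>))
     \<longlonglongrightarrow> (CLINT \<xi>|lborel. complex_of_real (g \<xi>) * cis (2 * pi * x * \<xi>) * complex_of_real (?E 0 \<xi>))"
  proof (rule integral_dominated_convergence[where w = "\<lambda>x. \<bar>g x\<bar>"])
    show "AE \<xi> in lborel. (\<lambda>n. complex_of_real (g \<xi>) * cis (2 * pi * x * \<xi>) * complex_of_real (?E (?d n) \<xi>))
      \<longlonglongrightarrow> complex_of_real (g \<xi>) * cis (2 * pi * x * \<xi>) * complex_of_real (?E 0 \<xi>)"
      by (intro AE_I2 tendsto_intros LIMSEQ_inverse_real_of_nat)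
    show "AE \<xi> in lborel. norm (complex_of_real (g \<xi>) * cis (2 * pi * x * \<xi>) * complex_of_real (?E (?d n) \<xi>)) \<le> \<bar>g \<xi>\<bar>" for n
      by (intro AE_I2) (simp add: norm_mult mult_left_le)
  qed (use g in auto)
  moreover have "(\<lambda>n. complex_of_real (\<integral>y. f y * (exp (- pi * ((x - y) / ?d n)\<^sup>2) / ?d n) \<partial>lborel)) \<longlonglongrightarrow> complex_of_real (f x)"
    using cont f
    by (intro tendsto_of_real filterlim_compose[OF kernel.conv_tendsto[OF gaussian_kernel] filterlim_inverse_Suc_at_right_0])
       (auto simp: continuous_on_eq_continuous_at)
  ultimately have "(CLINT \<xi>|lborel. complex_of_real (g \<xi>) * cis (2 * pi * x * \<xi>)) = complex_of_real (f x)"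
    by (subst (asm) swap) (auto dest: LIMSEQ_unique)
  \<comment> \<open>The limit is the transform of g at -x. As g is real, reflecting the argument
    conjugates the transform, and f(x) is real, so the usual reflection disappears.\<close>
  then have "fourier g (- x) = complex_of_real (f x)"
    by (simp add: fourier_def mult.assoc mult.commute[of x])
  then show ?thesis
    by (simp add: fourier_uminus) (metis complex_cnj_cnj complex_cnj_complex_of_real)
qed

text \<open>Symmetric in f and g, so that every construction can be read from either side. Both
  transforms being real, both functions are even, which is why neither direction carries a
  reflection.\<close>

definition fourier_pair :: "(real \<Rightarrow> real) \<Rightarrow> (real \<Rightarrow> real) \<Rightarrow> bool" where
  "fourier_pair f g \<longleftrightarrow> continuous_on UNIV f \<and> continuous_on UNIV g \<and>
     integrable lborel f \<and> integrable lborel g \<and>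
     (\<forall>\<xi>. fourier f \<xi> = complex_of_real (g \<xi>)) \<and> (\<forall>x. fourier g x = complex_of_real (f x))"

lemma fourier_pairD:
  assumes "fourier_pair f g"
  shows "continuous_on UNIV f" "continuous_on UNIV g" "integrable lborel f" "integrable lborel g"
    "fourier f \<xi> = complex_of_real (g \<xi>)" "fourier g x = complex_of_real (f x)"
  using assms by (auto simp: fourier_pair_def)

text \<open>As a transform of an integrable function g is continuous, and inversion gives the other
  transform. So a pair is obtained by computing a single transform.\<close>

lemma fourier_pairI:
  assumes "continuous_on UNIV f" "integrable lborel f" "integrable lborel g"
    and fg: "\<And>\<xi>. fourier f \<xi> = complex_of_real (g \<xi>)"
  shows "fourier_pair f g"
proof -
  have "continuous_on UNIV (\<lambda>\<xi>. Re (fourier f \<xi>))"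
    by (intro continuous_intros continuous_fourier assms)
  then have "continuous_on UNIV g" by (simp add: fg)
  then show ?thesis
    using assms fourier_inversion[OF assms] by (auto simp: fourier_pair_def)
qed

lemma fourier_pair_sym: "fourier_pair f g \<Longrightarrow> fourier_pair g f"
  by (auto simp: fourier_pair_def)

lemma fourier_pair_add:
  assumes "fourier_pair f g" "fourier_pair p q"
  shows "fourier_pair (\<lambda>x. f x + p x) (\<lambda>x. g x + q x)"
  using fourier_pairD[OF assms(1)] fourier_pairD[OF assms(2)]
  by (intro fourier_pairI continuous_intros) (auto simp: fourier_add)

lemma fourier_pair_cmult:
  assumes "fourier_pair f g"
  shows "fourier_pair (\<lambda>x. c * f x) (\<lambda>x. c * g x)"
  using fourier_pairD[OF assms]
  by (intro fourier_pairI continuous_intros) (auto simp: fourier_cmult)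

lemma fourier_pair_sum:
  assumes "\<And>i. i \<in> I \<Longrightarrow> fourier_pair (f i) (g i)"
  shows "fourier_pair (\<lambda>x. \<Sum>i\<in>I. f i x) (\<lambda>x. \<Sum>i\<in>I. g i x)"
proof -
  have 0: "fourier_pair (\<lambda>x. 0) (\<lambda>x. 0)"
    by (auto simp: fourier_pair_def fourier_def)
  show ?thesis
  proof (cases "finite I")
    case True
    then show ?thesis using assms
      by (induction I) (auto simp: 0 intro: fourier_pair_add)
  qed (simp add: 0)
qed

lemma fourier_pair_even:
  assumes "fourier_pair f g"
  shows "f (- x) = f x"
proof -
  have "complex_of_real (f (- x)) = complex_of_real (f x)"
    using fourier_uminus[of g x] by (simp add: fourier_pairD(6)[OF assms])
  then show ?thesis by (simp only: of_real_eq_iff)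
qed

lemma fourier_pair_abs_le:
  assumes "fourier_pair f g"
  shows "\<bar>f x\<bar> \<le> (\<integral>x. \<bar>g x\<bar> \<partial>lborel)"
  using norm_fourier_le[of g x] by (simp add: fourier_pairD(6)[OF assms])

section \<open>Dilations, translations and convolutions of pairs\<close>

lemma fourier_dilate:
  assumes "l > 0"
  shows "fourier (\<lambda>x. f (l * x)) \<xi> = fourier f (\<xi> / l) / l"
proof -
  have "fourier f (\<xi> / l) = \<bar>l\<bar> *\<^sub>R (CLINT x|lborel. complex_of_real (f (0 + l * x)) * cis (- 2 * pi * (0 + l * x) * (\<xi> / l)))"
    unfolding fourier_def using assms by (intro lborel_integral_real_affine) auto
  then show ?thesis
    using assms by (simp add: fourier_def scaleR_conv_of_real mult.assoc)
qed

lemma fourier_pair_dilate: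
  assumes "fourier_pair f g" "l > 0"
  shows "fourier_pair (\<lambda>x. f (l * x)) (\<lambda>x. g (x / l) / l)"
proof (rule fourier_pairI)
  note fg = fourier_pairD[OF assms(1)]
  show "continuous_on UNIV (\<lambda>x. f (l * x))"
    by (intro continuous_on_compose2[OF fg(1)] continuous_intros) auto
  show "integrable lborel (\<lambda>x. f (l * x))"
    using lborel_integrable_real_affine[OF fg(3), of l 0] assms by simp
  show "integrable lborel (\<lambda>x. g (x / l) / l)"
    using lborel_integrable_real_affine[OF fg(4), of "1 / l" 0] assms by simp
qed (use assms fourier_pairD(5)[OF assms(1)] in \<open>simp add: fourier_dilate\<close>)

lemma fourier_translate:
  "fourier (\<lambda>x. f (x + t)) \<xi> = cis (2 * pi * t * \<xi>) * fourier f \<xi>"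
proof -
  have "fourier f \<xi> = \<bar>1\<bar> *\<^sub>R (CLINT x|lborel. complex_of_real (f (t + 1 * x)) * cis (- 2 * pi * (t + 1 * x) * \<xi>))"
    unfolding fourier_def by (intro lborel_integral_real_affine) auto
  also have "\<dots> = (CLINT x|lborel. cis (- 2 * pi * t * \<xi>) * (complex_of_real (f (x + t)) * cis (- 2 * pi * x * \<xi>)))"
    by (simp add: mult.left_commute[of "cis _"] cis_mult algebra_simps)
  also have "\<dots> = cis (- 2 * pi * t * \<xi>) * fourier (\<lambda>x. f (x + t)) \<xi>"
    by (simp add: fourier_def)
  finally show ?thesis by (simp add: mult.assoc[symmetric] cis_mult)
qed

text \<open>Translating both ways keeps the transform real: the two phases add up to a cosine. Its
  factor 2 at the origin yields the value 2w there for the two tents.\<close>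

lemma fourier_pair_translate:
  assumes "fourier_pair f g"
  shows "fourier_pair (\<lambda>x. f (x - t) + f (x + t)) (\<lambda>\<xi>. 2 * cos (2 * pi * t * \<xi>) * g \<xi>)"
proof (rule fourier_pairI)
  note fg = fourier_pairD[OF assms]
  show "continuous_on UNIV (\<lambda>x. f (x - t) + f (x + t))"
    by (intro continuous_intros continuous_on_compose2[OF fg(1)]) auto
  have i: "integrable lborel (\<lambda>x. f (x + s))" for s
    using lborel_integrable_real_affine[OF fg(3), of 1 s] by (simp add: add.commute)
  from i[of t] i[of "-t"] show "integrable lborel (\<lambda>x. f (x - t) + f (x + t))" by simp
  have [measurable]: "g \<in> borel_measurable borel" using fg by auto
  show "integrable lborel (\<lambda>\<xi>. 2 * cos (2 * pi * t * \<xi>) * g \<xi>)"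
  proof (rule Bochner_Integration.integrable_bound)
    show "integrable lborel (\<lambda>\<xi>. 2 * g \<xi>)" using fg by simp
    show "AE \<xi> in lborel. norm (2 * cos (2 * pi * t * \<xi>) * g \<xi>) \<le> norm (2 * g \<xi>)"
      by (intro AE_I2) (simp add: abs_mult mult_left_le_one_le)
  qed auto
  fix \<xi>
  have "fourier (\<lambda>x. f (x - t) + f (x + t)) \<xi> = fourier (\<lambda>x. f (x + - t)) \<xi> + fourier (\<lambda>x. f (x + t)) \<xi>"
    using i[of t] i[of "-t"] by (simp add: fourier_add)
  also have "\<dots> = (cis (- (2 * pi * t * \<xi>)) + cis (2 * pi * t * \<xi>)) * g \<xi>"
    unfolding fourier_translate fg(5) by (simp add: distrib_right)
  also have "cis (- (2 * pi * t * \<xi>)) + cis (2 * pi * t * \<xi>) = complex_of_real (2 * cos (2 * pi * t * \<xi>))"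
    by (simp add: complex_eq_iff)
  finally show "fourier (\<lambda>x. f (x - t) + f (x + t)) \<xi> = complex_of_real (2 * cos (2 * pi * t * \<xi>) * g \<xi>)"
    by simp
qed

text \<open>Proved from the product side, whose continuity is immediate; that of the convolution
  then comes from \<open>fourier_pairI\<close>.\<close>

lemma fourier_pair_conv:
  assumes "fourier_pair f g" "fourier_pair K k"
  shows "fourier_pair (\<lambda>x. \<integral>y. f y * K (x - y) \<partial>lborel) (\<lambda>\<xi>. g \<xi> * k \<xi>)"
proof (rule fourier_pair_sym, rule fourier_pairI)
  note fg = fourier_pairD[OF assms(1)] and Kk = fourier_pairD[OF assms(2)]
  have [measurable]: "f \<in> borel_measurable borel" "g \<in> borel_measurable borel"
     "K \<in> borel_measurable borel" "k \<in> borel_measurable borel"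
    using fg Kk by auto
  show "continuous_on UNIV (\<lambda>\<xi>. g \<xi> * k \<xi>)"
    by (intro continuous_intros fg Kk)
  show "integrable lborel (\<lambda>\<xi>. g \<xi> * k \<xi>)"
  proof (rule Bochner_Integration.integrable_bound)
    show "integrable lborel (\<lambda>\<xi>. (\<integral>x. \<bar>K x\<bar> \<partial>lborel) * g \<xi>)" using fg by simp
    show "AE \<xi> in lborel. norm (g \<xi> * k \<xi>) \<le> norm ((\<integral>x. \<bar>K x\<bar> \<partial>lborel) * g \<xi>)"
      by (intro AE_I2)
         (simp add: abs_mult mult.commute mult_left_mono fourier_pair_abs_le[OF fourier_pair_sym[OF assms(2)]])
  qed auto
  have "integrable (lborel \<Otimes>\<^sub>M lborel) (\<lambda>(y, x). f y * K (x - y))"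
  proof (rule lborel_pair.Fubini_integrable)
    have tr: "integrable lborel (\<lambda>x. K (x - y))" "(\<integral>x. \<bar>K (x - y)\<bar> \<partial>lborel) = (\<integral>x. \<bar>K x\<bar> \<partial>lborel)" for y
      using lborel_integrable_real_affine[OF Kk(3), of 1 "-y"]
        lborel_integral_real_affine[of 1 "\<lambda>x. \<bar>K x\<bar>" "-y"] by simp_all
    show "integrable lborel (\<lambda>y. \<integral>x. norm (case (y, x) of (y, x) \<Rightarrow> f y * K (x - y)) \<partial>lborel)"
      using fg(3) by (simp add: abs_mult tr)
    show "AE y in lborel. integrable lborel (\<lambda>x. case (y, x) of (y, x) \<Rightarrow> f y * K (x - y))"
      using tr by simp
  qed auto
  then show "integrable lborel (\<lambda>x. \<integral>y. f y * K (x - y) \<partial>lborel)"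
    by (rule lborel_pair.integrable_snd)
  fix x
  define h where "h = (\<lambda>y \<xi>. complex_of_real (K y) * (complex_of_real (g \<xi>) * cis (- 2 * pi * \<xi> * (x + y))))"
  have h: "h y \<xi> = complex_of_real (g \<xi>) * (complex_of_real (K y) * cis (- 2 * pi * y * \<xi>)) * cis (- 2 * pi * \<xi> * x)" for y \<xi>
  proof -
    have "cis (- 2 * pi * \<xi> * (x + y)) = cis (- 2 * pi * y * \<xi>) * cis (- 2 * pi * \<xi> * x)"
      by (simp add: cis_mult algebra_simps)
    then show ?thesis by (simp add: h_def)
  qed
  have "fourier (\<lambda>\<xi>. g \<xi> * k \<xi>) x = (CLINT \<xi>|lborel. (CLINT y|lborel. h y \<xi>))"
    unfolding h by (simp add: Kk(5)[symmetric] fourier_def)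
  also have "\<dots> = (CLINT y|lborel. (CLINT \<xi>|lborel. h y \<xi>))"
  proof (rule lborel_pair.Fubini_integral)
    show "integrable (lborel \<Otimes>\<^sub>M lborel) (\<lambda>(y, \<xi>). h y \<xi>)"
      by (rule integrable_lborel_pair_bound[OF Kk(3) fg(4)]) (auto simp: h_def norm_mult)
  qed
  also have "(\<lambda>y. CLINT \<xi>|lborel. h y \<xi>) = (\<lambda>y. complex_of_real (K y) * fourier g (x + y))"
    by (simp add: h_def fourier_def)
  also have "(CLINT y|lborel. complex_of_real (K y) * fourier g (x + y))
     = complex_of_real (\<integral>y. K y * f (x + y) \<partial>lborel)"
    by (simp add: fg(6) flip: of_real_mult)
  \<comment> \<open>Fubini has produced a correlation; evenness of K makes it a convolution.\<close>
  also have "(\<integral>y. K y * f (x + y) \<partial>lborel) = (\<integral>y. f y * K (x - y) \<partial>lborel)"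
    using lborel_integral_real_affine[of 1 "\<lambda>y. K y * f (x + y)" "- x"]
      fourier_pair_even[OF assms(2), of "x - y" for y]
    by (simp add: mult.commute)
  finally show "fourier (\<lambda>\<xi>. g \<xi> * k \<xi>) x = complex_of_real (\<integral>y. f y * K (x - y) \<partial>lborel)" .
qed

section \<open>Explicit pairs\<close>

text \<open>Folding onto the half-line removes the absolute value from the tent and from exp (-
  |x|), so that the fundamental theorem of calculus meets a smooth integrand.\<close>

lemma fourier_even_eq:
  assumes f: "integrable lborel f" and even: "\<And>x. f (- x) = f x"
  shows "fourier f \<xi> = complex_of_real (2 * (\<integral>x. f x * cos (2 * pi * \<xi> * x) * indicator {0..} x \<partial>lborel))"
proof -
  have [measurable]: "f \<in> borel_measurable borel" using f by auto
  have int: "integrable lborel (\<lambda>x. complex_of_real (f x) * cis (- 2 * pi * x * \<xi>))"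
    by (intro integrable_mult_cis f) auto
  let ?c = "\<lambda>x. f x * cos (2 * pi * \<xi> * x)"
  let ?s = "\<lambda>x. f x * sin (2 * pi * \<xi> * x)"
  have ci: "integrable lborel (\<lambda>x. ?c x * indicator A x)" if [measurable]: "A \<in> sets borel" for A
    by (rule Bochner_Integration.integrable_bound[OF f])
       (auto simp: abs_mult mult_left_le indicator_def)
  have "(\<integral>x. ?c x \<partial>lborel) = (\<integral>x. ?c x * indicator {0..} x + ?c x * indicator {..<0} x \<partial>lborel)"
    by (intro Bochner_Integration.integral_cong) (auto simp: indicator_def)
  also have "\<dots> = (\<integral>x. ?c x * indicator {0..} x \<partial>lborel) + (\<integral>x. ?c x * indicator {..<0} x \<partial>lborel)"
    by (intro Bochner_Integration.integral_add ci) auto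
  also have "(\<integral>x. ?c x * indicator {..<0} x \<partial>lborel) = (\<integral>x. ?c x * indicator {0<..} x \<partial>lborel)"
    using lborel_integral_real_affine[of "-1" "\<lambda>x. ?c x * indicator {..<0} x" 0]
    by (simp add: even indicator_def)
  also have "\<dots> = (\<integral>x. ?c x * indicator {0..} x \<partial>lborel)"
  proof (rule integral_cong_AE)
    show "AE x in lborel. ?c x * indicator {0<..} x = ?c x * indicator {0..} x"
      using AE_lborel_singleton[of 0] by eventually_elim (auto simp: indicator_def)
  qed auto
  finally have c: "(\<integral>x. ?c x \<partial>lborel) = 2 * (\<integral>x. ?c x * indicator {0..} x \<partial>lborel)" by simp
  have "(\<integral>x. ?s x \<partial>lborel) = - (\<integral>x. ?s x \<partial>lborel)"
    using lborel_integral_real_affine[of "-1" ?s 0] by (simp add: even)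
  then have s: "(\<integral>x. ?s x \<partial>lborel) = 0" by simp
  show ?thesis
  proof (rule complex_eqI)
    have "Re (fourier f \<xi>) = (\<integral>x. ?c x \<partial>lborel)"
      unfolding fourier_def using int by (simp add: mult.commute mult.left_commute flip: integral_Re)
    then show "Re (fourier f \<xi>) = Re (complex_of_real (2 * (\<integral>x. ?c x * indicator {0..} x \<partial>lborel)))"
      using c by simp
    have "Im (fourier f \<xi>) = - (\<integral>x. ?s x \<partial>lborel)"
      unfolding fourier_def using int by (simp add: mult.commute mult.left_commute flip: integral_Im)
    then show "Im (fourier f \<xi>) = Im (complex_of_real (2 * (\<integral>x. ?c x * indicator {0..} x \<partial>lborel)))"
      using s by simp
  qed
qed

section \<open>The tent and the Fejer kernel\<close>

definition tent :: "real \<Rightarrow> real" where "tent x = max 0 (1 - \<bar>x\<bar>)"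

definition fejer :: "real \<Rightarrow> real" where
  "fejer x = (if x = 0 then 1 else (sin (pi * x) / (pi * x))\<^sup>2)"

lemma integrable_inverse_square_bound:
  fixes f :: "real \<Rightarrow> real"
  assumes [measurable]: "f \<in> borel_measurable borel" and "\<And>x. \<bar>f x\<bar> \<le> B / (1 + x\<^sup>2)"
  shows "integrable lborel f"
proof (rule Bochner_Integration.integrable_bound)
  show "integrable lborel (\<lambda>x::real. B * (1 / (1 + x\<^sup>2)))"
    using integrable_inverse_1_plus_square_lborel by (intro integrable_mult_right)
  show "AE x in lborel. norm (f x) \<le> norm (B * (1 / (1 + x\<^sup>2)))"
    unfolding times_divide_eq_right mult_1_right real_norm_def
    by (intro AE_I2 order_trans[OF assms(2) abs_ge_self])
qed auto

lemma fejer_nonneg: "0 \<le> fejer x"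
  by (simp add: fejer_def)

lemma fejer_le_1: "fejer x \<le> 1"
proof -
  have "\<bar>sin (pi * x)\<bar> \<le> \<bar>pi * x\<bar>" by (rule abs_sin_x_le_abs_x)
  then show ?thesis
    by (auto simp: fejer_def power_le_one_iff abs_square_le_1 divide_le_eq_1)
qed

lemma fejer_decay: "fejer x * x\<^sup>2 \<le> 1 / pi\<^sup>2"
  by (auto simp: fejer_def power_divide power_mult_distrib divide_simps abs_square_le_1)

lemma integrable_tent: "integrable lborel tent"
proof (rule integrable_inverse_square_bound[where B = 2])
  show "tent \<in> borel_measurable borel"
    unfolding tent_def by measurable
  fix x :: real
  show "\<bar>tent x\<bar> \<le> 2 / (1 + x\<^sup>2)"
  proof (cases "\<bar>x\<bar> \<le> 1")
    case True
    then have "x\<^sup>2 \<le> 1" by (simp add: abs_square_le_1)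
    then have "2 / (1 + x\<^sup>2) \<ge> 1" by (simp add: divide_simps add_pos_nonneg)
    then show ?thesis by (simp add: tent_def)
  qed (simp add: tent_def)
qed

lemma fourier_tent: "fourier tent \<xi> = complex_of_real (fejer \<xi>)"
proof -
  define w where "w = 2 * pi * \<xi>"
  have "(\<integral>x. tent x * cos (2 * pi * \<xi> * x) * indicator {0..} x \<partial>lborel)
      = (\<integral>x. ((1 - x) * cos (w * x)) * indicator {0..1} x \<partial>lborel)"
    by (intro Bochner_Integration.integral_cong) (auto simp: tent_def indicator_def w_def)
  also have "\<dots> = fejer \<xi> / 2"
  proof (cases "\<xi> = 0")
    case True
    have "(\<integral>x. (1 - x) * indicator {0..1} x \<partial>lborel) = (1 - 1\<^sup>2 / 2) - (0 - 0\<^sup>2 / 2 :: real)"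
      by (rule integral_FTC_Icc_real) (auto intro!: derivative_eq_intros)
    then show ?thesis using True by (simp add: w_def fejer_def)
  next
    case False
    then have w: "w \<noteq> 0" by (simp add: w_def)
    define F where "F = (\<lambda>x. (1 - x) * sin (w * x) / w - cos (w * x) / w\<^sup>2)"
    have "(\<integral>x. ((1 - x) * cos (w * x)) * indicator {0..1} x \<partial>lborel) = F 1 - F 0"
      unfolding F_def using w
      by (intro integral_FTC_Icc_real)
         (auto intro!: derivative_eq_intros continuous_intros simp: field_simps power2_eq_square)
    also have "\<dots> = (1 - cos w) / w\<^sup>2" by (simp add: F_def diff_divide_distrib)
    also have "1 - cos w = 2 * (sin (pi * \<xi>))\<^sup>2"
      using cos_double_sin[of "pi * \<xi>"] by (simp add: w_def mult.assoc)
    finally show ?thesis using False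
      by (simp add: fejer_def w_def power_divide power_mult_distrib)
  qed
  finally have I: "2 * (\<integral>x. tent x * cos (2 * pi * \<xi> * x) * indicator {0..} x \<partial>lborel) = fejer \<xi>" by simp
  have "tent (- x) = tent x" for x by (simp add: tent_def)
  then show ?thesis using fourier_even_eq[OF integrable_tent, of \<xi>] unfolding I by simp
qed

lemma fourier_pair_tent: "fourier_pair tent fejer"
proof (rule fourier_pairI)
  show "continuous_on UNIV tent"
    unfolding tent_def by (intro continuous_intros)
  show "integrable lborel tent" by (rule integrable_tent)
  show "integrable lborel fejer"
  proof (rule integrable_inverse_square_bound[where B = 2])
    show "fejer \<in> borel_measurable borel"
      unfolding fejer_def by measurable
    fix x :: real
    have "1 / pi\<^sup>2 \<le> 1" using pi_gt3 by (simp add: divide_simps one_le_power)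
    then have "fejer x * (1 + x\<^sup>2) \<le> 2"
      using fejer_le_1[of x] fejer_decay[of x] unfolding distrib_left by linarith
    then show "\<bar>fejer x\<bar> \<le> 2 / (1 + x\<^sup>2)"
      using fejer_nonneg[of x] by (simp add: divide_simps add_pos_nonneg)
  qed
qed (rule fourier_tent)

text \<open>The total mass is read off from the pair: it is the transform of \<open>fejer\<close> at
  0, that is \<open>tent 0\<close>.\<close>

lemma fejer_kernel: "kernel fejer 1 (1 / pi\<^sup>2)"
proof
  have "complex_of_real (\<integral>x. fejer x \<partial>lborel) = fourier fejer 0"
    by (simp add: fourier_def flip: integral_complex_of_real)
  also have "\<dots> = 1" using fourier_pairD(6)[OF fourier_pair_tent, of 0] by (simp add: tent_def)
  finally show "(\<integral>x. fejer x \<partial>lborel) = 1"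
    using of_real_eq_1_iff by blast
qed (use fourier_pairD[OF fourier_pair_tent] fejer_nonneg fejer_le_1 fejer_decay in auto)

section \<open>A positive self-dual function of order 1/x^2\<close>

lemma fourier_pair_laplace:
  "fourier_pair (\<lambda>x. exp (- \<bar>x\<bar>)) (\<lambda>\<xi>. 2 / (1 + (2 * pi * \<xi>)\<^sup>2))"
proof (rule fourier_pairI)
  show "continuous_on UNIV (\<lambda>x::real. exp (- \<bar>x\<bar>))" by (intro continuous_intros)
  show int: "integrable lborel (\<lambda>x::real. exp (- \<bar>x\<bar>))"
  proof (rule integrable_inverse_square_bound[where B = 2])
    fix x :: real
    have "1 + x\<^sup>2 \<le> 2 * exp \<bar>x\<bar>"
      using exp_lower_Taylor_quadratic[of "\<bar>x\<bar>"] by (simp add: field_simps)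
    then show "\<bar>exp (- \<bar>x\<bar>)\<bar> \<le> 2 / (1 + x\<^sup>2)"
      by (simp add: exp_minus divide_simps add_pos_nonneg mult.commute)
  qed auto
  show "integrable lborel (\<lambda>\<xi>. 2 / (1 + (2 * pi * \<xi>)\<^sup>2))"
  proof (rule integrable_inverse_square_bound[where B = 2])
    fix x :: real
    have "1\<^sup>2 \<le> (2 * pi)\<^sup>2" using pi_gt3 by (intro power_mono) auto
    then have "1 * x\<^sup>2 \<le> (2 * pi)\<^sup>2 * x\<^sup>2" by (intro mult_right_mono) auto
    then show "\<bar>2 / (1 + (2 * pi * x)\<^sup>2)\<bar> \<le> 2 / (1 + x\<^sup>2)"
      unfolding power_mult_distrib by (simp add: frac_le add_pos_nonneg)
  qed auto
  fix \<xi> :: real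
  define w where "w = 2 * pi * \<xi>"
  have w: "1 + w\<^sup>2 > 0" by (simp add: add_pos_nonneg)
  \<comment> \<open>The relation c + c w^2 = 1 keeps the differentiation of \<open>F\<close> free of
    division.\<close>
  define c where "c = 1 / (1 + w\<^sup>2)"
  have c: "c + c * w\<^sup>2 = 1" "c \<ge> 0" using w by (auto simp: c_def field_simps)
  define F where "F = (\<lambda>x. c * (exp (- x) * (w * sin (w * x) - cos (w * x))))"
  have FTC: "(\<integral>x. (exp (- x) * cos (w * x)) * indicator {0..real n} x \<partial>lborel) = F (real n) - F 0" for n
  proof (rule integral_FTC_Icc_real)
    fix x :: real
    have "(F has_real_derivative c * (exp (- x) * (w * (cos (w * x) * w) + sin (w * x) * w)
        - exp (- x) * (w * sin (w * x) - cos (w * x)))) (at x)"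
      unfolding F_def by (auto intro!: derivative_eq_intros simp: algebra_simps)
    also have "c * (exp (- x) * (w * (cos (w * x) * w) + sin (w * x) * w)
        - exp (- x) * (w * sin (w * x) - cos (w * x))) = (c + c * w\<^sup>2) * (exp (- x) * cos (w * x))"
      by (simp add: algebra_simps power2_eq_square)
    finally show "(F has_real_derivative exp (- x) * cos (w * x)) (at x)" by (simp add: c)
  qed (auto intro!: continuous_intros)
  have "(\<lambda>n. F (real n)) \<longlonglongrightarrow> 0"
  proof (rule Lim_null_comparison)
    show "\<forall>\<^sub>F n in sequentially. norm (F (real n)) \<le> exp (-1) ^ n * (c * (\<bar>w\<bar> + 1))"
    proof (intro always_eventually allI)
      fix n :: nat
      have "\<bar>w * sin (w * real n) - cos (w * real n)\<bar> \<le> \<bar>w * sin (w * real n)\<bar> + \<bar>cos (w * real n)\<bar>" by linarith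
      also have "\<dots> \<le> \<bar>w\<bar> + 1" by (intro add_mono) (auto simp: abs_mult mult_left_le)
      finally show "norm (F (real n)) \<le> exp (-1) ^ n * (c * (\<bar>w\<bar> + 1))"
        using c(2) by (simp add: F_def abs_mult mult_left_mono mult.left_commute[of c] flip: exp_of_nat_mult)
    qed
    have "(\<lambda>n. exp (- 1 :: real) ^ n) \<longlonglongrightarrow> 0"
      by (intro LIMSEQ_realpow_zero) auto
    then show "(\<lambda>n. exp (-1) ^ n * (c * (\<bar>w\<bar> + 1))) \<longlonglongrightarrow> 0"
      by (rule tendsto_mult_left_zero)
  qed
  then have "(\<lambda>n. F (real n) - F 0) \<longlonglongrightarrow> 0 - F 0"
    by (intro tendsto_intros)
  moreover have "(\<lambda>n. \<integral>x. (exp (- x) * cos (w * x)) * indicator {0..real n} x \<partial>lborel)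
     \<longlonglongrightarrow> (\<integral>x. exp (- \<bar>x\<bar>) * cos (w * x) * indicator {0..} x \<partial>lborel)"
  proof (rule integral_dominated_convergence[OF _ _ int])
    show "AE x in lborel. (\<lambda>n. (exp (- x) * cos (w * x)) * indicator {0..real n} x)
        \<longlonglongrightarrow> exp (- \<bar>x\<bar>) * cos (w * x) * indicator {0..} x"
    proof (intro AE_I2 tendsto_eventually)
      fix x :: real
      show "\<forall>\<^sub>F n in sequentially. exp (- x) * cos (w * x) * indicator {0..real n} x = exp (- \<bar>x\<bar>) * cos (w * x) * indicator {0..} x"
        using eventually_ge_at_top[of "nat \<lceil>x\<rceil>"]
        by eventually_elim (auto simp: indicator_def nat_le_iff ceiling_le_iff)
    qed
    show "AE x in lborel. norm ((exp (- x) * cos (w * x)) * indicator {0..real n} x) \<le> exp (- \<bar>x\<bar>)" for n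
      by (intro AE_I2) (auto simp: indicator_def abs_mult mult_left_le)
  qed auto
  ultimately have "(\<integral>x. exp (- \<bar>x\<bar>) * cos (w * x) * indicator {0..} x \<partial>lborel) = 0 - F 0"
    unfolding FTC by (rule LIMSEQ_unique[rotated])
  then show "fourier (\<lambda>x. exp (- \<bar>x\<bar>)) \<xi> = complex_of_real (2 / (1 + (2 * pi * \<xi>)\<^sup>2))"
    by (subst fourier_even_eq[OF int]) (auto simp: F_def w_def c_def)
qed

text \<open>A function plus its transform is self-dual. For the two-sided exponential the sum is
  positive and decays like 1/x^2, the order of the decay of the transform of the tents.\<close>

definition heavy :: "real \<Rightarrow> real" where
  "heavy x = exp (- \<bar>x\<bar>) + 2 / (1 + (2 * pi * x)\<^sup>2)"

lemma fourier_pair_heavy: "fourier_pair heavy heavy"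
  using fourier_pair_add[OF fourier_pair_laplace fourier_pair_sym[OF fourier_pair_laplace]]
  unfolding heavy_def by (simp add: add.commute)

lemma heavy_ge: "heavy x \<ge> 1 / (2 * pi\<^sup>2) / (1 + x\<^sup>2)"
proof -
  have "1 \<le> (2 * pi)\<^sup>2" using pi_gt3 by (intro one_le_power) auto
  then have "1 + (2 * pi * x)\<^sup>2 \<le> (2 * pi)\<^sup>2 * (1 + x\<^sup>2)"
    by (simp add: distrib_left power_mult_distrib)
  then have "2 / ((2 * pi)\<^sup>2 * (1 + x\<^sup>2)) \<le> 2 / (1 + (2 * pi * x)\<^sup>2)"
    by (intro divide_left_mono) (auto simp: add_pos_nonneg)
  also have "\<dots> \<le> heavy x" by (simp add: heavy_def)
  finally show ?thesis by (simp add: power_mult_distrib)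
qed

section \<open>Compact support on both sides\<close>

text \<open>An uncertainty principle. As f has compact support, g is the sum of an everywhere
  convergent power series, here expanded around a point beyond the support of g; vanishing on a
  half-line forces g = 0, and inversion gives f = 0.\<close>

lemma fourier_pair_compact_supports:
  assumes fg: "fourier_pair f g"
    and f0: "\<And>x. \<bar>x\<bar> \<ge> R \<Longrightarrow> f x = 0" and g0: "\<And>x. \<bar>x\<bar> \<ge> R \<Longrightarrow> g x = 0"
  shows "f x = 0"
proof -
  note D = fourier_pairD[OF fg]
  have [measurable]: "f \<in> borel_measurable borel" using D by auto
  \<comment> \<open>Plays two parts: g(S + t) = 0 for all t \<ge> 0, and the support of f lies in
    |x| \<le> S, which bounds the terms of the series.\<close>
  define S where "S = \<bar>R\<bar> + 1"
  define c where "c = (\<lambda>n. CLINT x|lborel. complex_of_real (f x) * cis (- 2 * pi * x * S) * ((\<i> * complex_of_real (- 2 * pi * x)) ^ n /\<^sub>R fact n))"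
  have sums: "(\<lambda>n. c n * complex_of_real t ^ n) sums complex_of_real (g (S + t))" for t
  proof -
    define a where "a = (\<lambda>n x. complex_of_real (f x) * cis (- 2 * pi * x * S) * ((\<i> * complex_of_real (- 2 * pi * x * t)) ^ n /\<^sub>R fact n))"
    define B where "B = 2 * pi * S * \<bar>t\<bar>"
    have B: "B \<ge> 0" by (simp add: B_def S_def)
    have na: "norm (a n x) \<le> \<bar>f x\<bar> * (B ^ n /\<^sub>R fact n)" for n x
    proof (cases "\<bar>x\<bar> \<le> S")
      case True
      then have "(2 * pi * \<bar>x\<bar> * \<bar>t\<bar>) ^ n \<le> B ^ n"
        unfolding B_def by (intro power_mono mult_right_mono mult_left_mono) auto
      then show ?thesis
        by (simp add: a_def norm_mult norm_power abs_mult divide_right_mono mult_left_mono)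
    next
      case False
      then show ?thesis using f0[of x] by (simp add: a_def S_def)
    qed
    have am [measurable]: "a n \<in> borel_measurable borel" for n
      unfolding a_def by measurable
    have ai: "integrable lborel (a n)" for n
    proof (rule Bochner_Integration.integrable_bound)
      show "integrable lborel (\<lambda>x. \<bar>f x\<bar> * (B ^ n /\<^sub>R fact n))" using D by auto
      show "AE x in lborel. norm (a n x) \<le> norm (\<bar>f x\<bar> * (B ^ n /\<^sub>R fact n))"
        using na[of n] by (intro AE_I2) (auto intro: order_trans[OF _ abs_ge_self])
    qed auto
    have "(\<lambda>n. integral\<^sup>L lborel (a n)) sums (\<integral>x. (\<Sum>n. a n x) \<partial>lborel)"
    proof (rule sums_integral[OF ai])
      show "AE x in lborel. summable (\<lambda>n. norm (a n x))"
        by (intro AE_I2 summable_comparison_test'[OF summable_mult[OF summable_exp_generic[of B]]])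
           (use na in auto)
      show "summable (\<lambda>n. \<integral>x. norm (a n x) \<partial>lborel)"
      proof (rule summable_comparison_test'[where N = 0])
        show "summable (\<lambda>n. (\<integral>x. \<bar>f x\<bar> \<partial>lborel) * (B ^ n /\<^sub>R fact n))"
          by (intro summable_mult summable_exp_generic)
        fix n
        have "(\<integral>x. norm (a n x) \<partial>lborel) \<le> (\<integral>x. \<bar>f x\<bar> * (B ^ n /\<^sub>R fact n) \<partial>lborel)"
          using na D ai by (intro integral_mono) auto
        then show "norm (\<integral>x. norm (a n x) \<partial>lborel) \<le> (\<integral>x. \<bar>f x\<bar> \<partial>lborel) * (B ^ n /\<^sub>R fact n)"
          by simp
      qed
    qed
    also have "(\<lambda>x. \<Sum>n. a n x) = (\<lambda>x. complex_of_real (f x) * cis (- 2 * pi * x * (S + t)))"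
    proof
      fix x
      have "(\<lambda>n. a n x) sums (complex_of_real (f x) * cis (- 2 * pi * x * S) * exp (\<i> * complex_of_real (- 2 * pi * x * t)))"
        unfolding a_def by (intro sums_mult exp_converges)
      then show "(\<Sum>n. a n x) = complex_of_real (f x) * cis (- 2 * pi * x * (S + t))"
        by (simp add: sums_unique[symmetric] cis_conv_exp mult.assoc algebra_simps flip: exp_add)
    qed
    also have "(\<integral>x. complex_of_real (f x) * cis (- 2 * pi * x * (S + t)) \<partial>lborel) = complex_of_real (g (S + t))"
      using D(5)[of "S + t"] by (simp add: fourier_def)
    also have "(\<lambda>n. integral\<^sup>L lborel (a n)) = (\<lambda>n. c n * complex_of_real t ^ n)"
    proof -
      have "a n x = complex_of_real (f x) * cis (- 2 * pi * x * S)
          * ((\<i> * complex_of_real (- 2 * pi * x)) ^ n /\<^sub>R fact n) * complex_of_real t ^ n" for n x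
      proof -
        have "\<i> * complex_of_real (- 2 * pi * x * t) = (\<i> * complex_of_real (- 2 * pi * x)) * complex_of_real t"
          by simp
        then show ?thesis unfolding a_def by (simp only: power_mult_distrib) simp
      qed
      then show ?thesis unfolding c_def integral_mult_left_zero[symmetric]
        by (intro ext Bochner_Integration.integral_cong[OF refl])
    qed
    finally show ?thesis .
  qed
  have sumsR: "(\<lambda>n. Re (c n) * t ^ n) sums g (S + t)" for t
    using sums_Re[OF sums[of t]] by (simp flip: of_real_power)
  have gS: "g (S + t) = 0" if "t \<ge> 0" for t
    using that by (intro g0) (simp add: S_def)
  \<comment> \<open>Zeros of a nonzero power series are isolated: otherwise g would be nonzero at
    some S + s with s > 0. Degree 0 is excluded here and settled below by g(S) = 0.\<close>
  have c0: "Re (c n) = 0" if n: "n > 0" for n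
  proof (rule ccontr)
    assume "Re (c n) \<noteq> 0"
    then obtain s where s: "s > 0" "\<And>z. z \<in> cball 0 s - {0} \<Longrightarrow> g (S + z) \<noteq> 0"
      by (rule powser_0_nonzero[of 1 0 "\<lambda>n. Re (c n)" "\<lambda>t. g (S + t)" n, rotated 3])
         (use sumsR gS[of 0] n in auto)
    then have "g (S + s) \<noteq> 0" by auto
    then show False using gS[of s] s(1) by simp
  qed
  have "g (S + t) = 0" for t
  proof -
    have "(\<lambda>n. Re (c n) * t ^ n) = (\<lambda>n. Re (c n) * 0 ^ n)"
      using c0 by (auto simp: fun_eq_iff power_0_left)
    with sumsR[of t] have "(\<lambda>n. Re (c n) * 0 ^ n) sums g (S + t)" by (simp only:)
    from sums_unique2[OF this sumsR[of 0]] show ?thesis using gS[of 0] by simp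
  qed
  from this[of "y - S" for y] have "g = (\<lambda>y. 0)" by (simp add: fun_eq_iff)
  then show ?thesis using D(6)[of x] by (simp add: fourier_def)
qed

section \<open>Self-dual functions that are negative at the origin\<close>

lemma fourier_pair_self_dual_add:
  assumes "fourier_pair f g"
  shows "fourier_pair (\<lambda>x. f x + g x) (\<lambda>x. f x + g x)"
  using fourier_pair_add[OF assms fourier_pair_sym[OF assms]] by (simp add: add.commute)

lemma fourier_pair_abs_arg:
  assumes "fourier_pair f g"
  shows "f \<bar>x\<bar> = f x"
  using fourier_pair_even[OF assms, of x] by (simp add: abs_if)

text \<open>Each dilate of f plus its transform is self-dual. Dilations by factors on a fine grid in
  [1, 1 + \<eta>] carry the positive value at z to every x with z / x in that range. The transforms
  f (x / l) / l stretch the graph and cost the factor 1 + \<eta> in the radius.\<close>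

lemma self_dual_spread_positivity:
  assumes f: "fourier_pair f f" and f0: "f 0 \<le> 0" and \<rho>: "\<rho> > 0" and \<eta>: "\<eta> > 0"
    and nonneg: "\<And>x. \<bar>x\<bar> \<ge> \<rho> \<Longrightarrow> f x \<ge> 0"
    and z: "z \<ge> \<rho> * (1 + \<eta>)\<^sup>2" "f z > 0"
  obtains F where "fourier_pair F F" "F 0 \<le> 0"
    "\<And>x. \<bar>x\<bar> \<ge> \<rho> * (1 + \<eta>) \<Longrightarrow> F x \<ge> 0"
    "\<And>x. z / (1 + \<eta>) \<le> x \<Longrightarrow> x \<le> z \<Longrightarrow> F x > 0"
proof -
  have "z > 0" using z(1) \<rho> \<eta> by (auto intro: less_le_trans[rotated])
  have "isCont f z" using fourier_pairD(1)[OF f] by (simp add: continuous_on_eq_continuous_at)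
  then obtain d where d: "d > 0" "\<And>y. \<bar>y - z\<bar> < d \<Longrightarrow> \<bar>f y - f z\<bar> < f z"
    using z(2) unfolding continuous_at_eps_delta dist_real_def by metis
  \<comment> \<open>Makes the grid so fine that one step \<eta> / n changes l x by less than d
    whenever 0 < x \<le> z.\<close>
  obtain n :: nat where n: "real n > \<eta> * z / d" using reals_Archimedean2 by blast
  have n0: "real n > 0" using n \<eta> \<open>z > 0\<close> d(1) less_trans[of 0 "\<eta> * z / d" "real n"] by simp
  define l where "l = (\<lambda>i. 1 + real i * \<eta> / real n)"
  have l: "1 \<le> l i" "i \<le> n \<Longrightarrow> l i \<le> 1 + \<eta>" for i
    using \<eta> n0 by (auto simp: l_def field_simps)
  then have lpos: "l i > 0" for i by (auto intro: less_le_trans[of 0 1])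
  let ?t = "\<lambda>i x. f (l i * x) + f (x / l i) / l i"
  define F where "F = (\<lambda>x. \<Sum>i\<le>n. ?t i x)"
  have t_nonneg: "?t i x \<ge> 0" if "i \<le> n" "\<bar>x\<bar> \<ge> \<rho> * (1 + \<eta>)" for i x
  proof -
    have "\<rho> * 1 \<le> \<rho> * (1 + \<eta>)" using \<rho> \<eta> by (intro mult_left_mono) auto
    then have "\<rho> \<le> 1 * \<bar>x\<bar>" using that by simp
    also have "\<dots> \<le> l i * \<bar>x\<bar>" using l by (intro mult_right_mono) auto
    finally have "f (l i * x) \<ge> 0" using lpos[of i] by (intro nonneg) (simp add: abs_mult)
    have "\<rho> * l i \<le> \<rho> * (1 + \<eta>)" using l(2) that \<rho> by (intro mult_left_mono) auto
    then have "\<rho> \<le> \<bar>x / l i\<bar>" using that lpos[of i] by (simp add: field_simps)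
    then have "f (x / l i) / l i \<ge> 0" using nonneg lpos[of i] by simp
    with \<open>f (l i * x) \<ge> 0\<close> show ?thesis by simp
  qed
  show thesis
  proof
    show "fourier_pair F F" unfolding F_def
      by (intro fourier_pair_sum fourier_pair_self_dual_add fourier_pair_dilate f lpos)
    show "F 0 \<le> 0" unfolding F_def
      using f0 lpos by (intro sum_nonpos add_nonpos_nonpos) (auto intro!: divide_nonpos_pos)
    show "F x \<ge> 0" if "\<bar>x\<bar> \<ge> \<rho> * (1 + \<eta>)" for x
      unfolding F_def using t_nonneg that by (intro sum_nonneg) auto
    fix x assume x: "z / (1 + \<eta>) \<le> x" "x \<le> z"
    \<comment> \<open>The square in the assumption on z places the whole interval beyond the
      enlarged radius, so that no term of the sum is negative on it.\<close>
    have "\<rho> * (1 + \<eta>) * (1 + \<eta>) \<le> z" using z(1) by (simp add: power2_eq_square mult.assoc)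
    then have "\<rho> * (1 + \<eta>) \<le> z / (1 + \<eta>)" using \<eta> by (simp add: pos_le_divide_eq)
    then have x\<rho>: "\<rho> * (1 + \<eta>) \<le> x" using x by linarith
    have xpos: "x > 0" using x(1) \<open>z > 0\<close> \<eta> by (auto intro: less_le_trans[rotated])
    \<comment> \<open>The real index at which the grid factor would be exactly z / x; rounding down
      gives the grid factor just below.\<close>
    define q where "q = (z / x - 1) * real n / \<eta>"
    define i where "i = nat \<lfloor>q\<rfloor>"
    have zx: "1 \<le> z / x" "z / x \<le> 1 + \<eta>" using x xpos \<eta> by (auto simp: field_simps)
    have q0: "q \<ge> 0" using zx \<eta> by (simp add: q_def)
    have "q \<le> \<eta> * real n / \<eta>" unfolding q_def
      using zx \<eta> by (intro divide_right_mono mult_right_mono) auto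
    then have qn: "q \<le> real n" using \<eta> by simp
    have i: "real i \<le> q" "q < real i + 1" using q0 by (auto simp: i_def)
    have "i \<le> n" using i(1) qn by linarith
    have qz: "1 + q * \<eta> / real n = z / x" using n0 \<eta> by (simp add: q_def)
    have "l i \<le> 1 + q * \<eta> / real n" unfolding l_def
      using i(1) \<eta> n0 by (intro add_left_mono divide_right_mono mult_right_mono) auto
    then have up: "l i * x \<le> z" unfolding qz using xpos by (simp add: field_simps)
    have "q * \<eta> / real n \<le> (real i + 1) * \<eta> / real n"
      using i(2) \<eta> n0 by (intro divide_right_mono mult_right_mono) auto
    then have "z / x \<le> l i + \<eta> / real n" unfolding qz[symmetric] l_def
      by (simp add: distrib_right add_divide_distrib)
    then have "z \<le> (l i + \<eta> / real n) * x" using xpos by (simp add: pos_divide_le_eq)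
    also have "\<dots> \<le> l i * x + \<eta> / real n * z"
      using x(2) \<eta> n0 by (auto simp: distrib_right intro!: divide_right_mono mult_left_mono)
    also have "\<eta> / real n * z < d" using n n0 d(1) by (simp add: field_simps)
    finally have "\<bar>l i * x - z\<bar> < d" using up by linarith
    then have "f (l i * x) > 0" using d(2) by fastforce
    moreover have "f (x / l i) / l i \<ge> 0"
    proof -
      have "\<rho> * l i \<le> \<rho> * (1 + \<eta>)" using l(2) \<open>i \<le> n\<close> \<rho> by (intro mult_left_mono) auto
      then have "\<rho> \<le> \<bar>x / l i\<bar>" using x\<rho> lpos[of i] xpos by (simp add: field_simps)
      then show ?thesis using nonneg lpos[of i] by simp
    qed
    ultimately have "?t i x > 0" by simp
    then show "F x > 0" unfolding F_def
      using t_nonneg x\<rho> xpos \<open>i \<le> n\<close> by (intro sum_pos2[of _ i]) auto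
  qed
qed

text \<open>Balance at the origin: the transform of the tents contributes - 2w, and the compensating
  multiple of \<open>heavy\<close> contributes 6 D / w because \<open>heavy 0\<close> is 3. With D =
  4 E the sum is negative exactly when w^2 > 12 E.\<close>

lemma self_dual_strictify:
  assumes F: "fourier_pair F F" and F0: "F 0 \<le> 0" and \<rho>: "\<rho> > 0"
    and nonneg: "\<And>x. \<bar>x\<bar> \<ge> \<rho> \<Longrightarrow> F x \<ge> 0"
    and w: "0 < w" "w < X" "w\<^sup>2 > 12 * (1 + 1 / \<rho>\<^sup>2)"
    and pos: "\<And>x. X - w \<le> x \<Longrightarrow> x \<le> X + w \<Longrightarrow> F x > 0"
  obtains G c where "fourier_pair G G" "G 0 < 0" "c > 0" "\<And>x. \<bar>x\<bar> \<ge> \<rho> \<Longrightarrow> G x \<ge> c / (1 + x\<^sup>2)"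
proof -
  define E where "E = 1 + 1 / \<rho>\<^sup>2"
  \<comment> \<open>The Fejer decay bounds the transform of the two tents by 2 / (pi^2 w x^2), hence
    by 2 E / (pi^2 w (1 + x^2)). Comparison with the lower bound 1 / (2 pi^2) / (1 + x^2) of
    \<open>heavy\<close> leaves the factor 4 E / w.\<close>
  define D where "D = 4 * E"
  have D: "D > 0" by (simp add: D_def E_def add_pos_nonneg)
  define l where "l = 1 / w"
  have l: "l > 0" using w by (simp add: l_def)
  define \<tau> where "\<tau> = (\<lambda>x. tent (l * (x - X)) + tent (l * (x + X)))"
  define \<tau>' where "\<tau>' = (\<lambda>x. 2 * cos (2 * pi * X * x) * (fejer (x / l) / l))"
  have pair: "fourier_pair \<tau> \<tau>'" unfolding \<tau>_def \<tau>'_def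
    by (rule fourier_pair_translate[OF fourier_pair_dilate[OF fourier_pair_tent l]])
  have \<tau>'_le: "\<bar>\<tau>' x\<bar> \<le> D / w * heavy x" if "\<bar>x\<bar> \<ge> \<rho>" for x
  proof -
    have x: "x\<^sup>2 > 0" "x \<noteq> 0" using that \<rho> by auto
    have "\<bar>\<tau>' x\<bar> = 2 * \<bar>cos (2 * pi * X * x)\<bar> * (fejer (w * x) * w)"
      using w fejer_nonneg by (simp add: \<tau>'_def l_def abs_mult mult.commute)
    also have "\<dots> \<le> 2 * 1 * (fejer (w * x) * w)"
      using w fejer_nonneg by (intro mult_right_mono mult_left_mono) auto
    also have "fejer (w * x) * w = (fejer (w * x) * (w * x)\<^sup>2) / (w * x\<^sup>2)"
      using w(1) x(2) by (simp add: field_simps power2_eq_square)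
    also have "\<dots> \<le> (1 / pi\<^sup>2) / (w * x\<^sup>2)"
      using fejer_decay w x by (intro divide_right_mono) auto
    also have "2 * 1 * ((1 / pi\<^sup>2) / (w * x\<^sup>2)) = 2 / pi\<^sup>2 / w * (1 / x\<^sup>2)" by simp
    also have "\<dots> \<le> 2 / pi\<^sup>2 / w * (E / (1 + x\<^sup>2))"
      using inverse_square_le[OF \<rho> that] w unfolding E_def by (intro mult_left_mono) auto
    also have "\<dots> = D / w * (1 / (2 * pi\<^sup>2) / (1 + x\<^sup>2))" by (simp add: D_def)
    also have "\<dots> \<le> D / w * heavy x"
      using D w heavy_ge by (intro mult_left_mono) auto
    finally show ?thesis by simp
  qed
  \<comment> \<open>Of the two copies of D / w times \<open>heavy\<close>, one absorbs \<tau>'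
    outside the radius and the other remains as the lower bound of order 1/x^2.\<close>
  define p where "p = (\<lambda>x. (-1) * (\<tau> x + \<tau>' x) + 2 * D / w * heavy x)"
  have p: "fourier_pair p p" unfolding p_def
    by (intro fourier_pair_add fourier_pair_cmult fourier_pair_heavy fourier_pair_self_dual_add pair)
  have p0: "p 0 < 0"
  proof -
    have "12 * E < w * w" using w(3) by (simp add: E_def power2_eq_square)
    then have "6 * D / w < 2 * w" using w(1) by (simp add: pos_divide_less_eq D_def)
    moreover have "\<tau> 0 = 0" using w by (simp add: \<tau>_def tent_def l_def field_simps)
    moreover have "\<tau>' 0 = 2 * w" by (simp add: \<tau>'_def l_def fejer_def)
    moreover have "heavy 0 = 3" by (simp add: heavy_def)
    ultimately show ?thesis by (simp add: p_def)
  qed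
  have "\<exists>y\<in>{X - w..X + w}. \<forall>x\<in>{X - w..X + w}. F y \<le> F x"
    using w by (intro continuous_attains_inf continuous_on_subset[OF fourier_pairD(1)[OF F]]) auto
  then obtain m where m: "m > 0" "\<And>x. X - w \<le> x \<Longrightarrow> x \<le> X + w \<Longrightarrow> F x \<ge> m"
    using pos by (metis atLeastAtMost_iff)
  \<comment> \<open>The two tents add up to at most 2, and F is at least \<open>m\<close> where they
    live, whence m / 2. Evenness of F covers the mirror interval.\<close>
  have \<tau>_le: "m / 2 * \<tau> x \<le> F x" if "\<bar>x\<bar> \<ge> \<rho>" for x
  proof (cases "X - w \<le> \<bar>x\<bar> \<and> \<bar>x\<bar> \<le> X + w")
    case True
    have "\<tau> x \<le> 1 + 1" unfolding \<tau>_def by (intro add_mono) (auto simp: tent_def)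
    then have "m / 2 * \<tau> x \<le> m / 2 * 2" using m(1) by (intro mult_left_mono) auto
    also have "\<dots> \<le> F x" using m(2)[of "\<bar>x\<bar>"] True by (simp add: fourier_pair_abs_arg[OF F])
    finally show ?thesis .
  next
    case False
    then have "w \<le> \<bar>x - X\<bar>" "w \<le> \<bar>x + X\<bar>" using w by linarith+
    then have "\<tau> x = 0" using w by (simp add: \<tau>_def tent_def l_def abs_mult)
    then show ?thesis using nonneg[OF that] by simp
  qed
  show thesis
  proof (rule that[of "\<lambda>x. F x + m / 2 * p x" "m / 2 * (D / w * (1 / (2 * pi\<^sup>2)))"])
    show "fourier_pair (\<lambda>x. F x + m / 2 * p x) (\<lambda>x. F x + m / 2 * p x)"
      by (intro fourier_pair_add fourier_pair_cmult F p)
    show "F 0 + m / 2 * p 0 < 0"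
      using F0 p0 m(1) by (intro add_nonpos_neg mult_pos_neg) auto
    show "m / 2 * (D / w * (1 / (2 * pi\<^sup>2))) > 0" using m D w by simp
    fix x assume x: "\<bar>x\<bar> \<ge> \<rho>"
    have "m / 2 * (D / w * (1 / (2 * pi\<^sup>2))) / (1 + x\<^sup>2) = m / 2 * (D / w * (1 / (2 * pi\<^sup>2) / (1 + x\<^sup>2)))"
      by simp
    also have "\<dots> \<le> m / 2 * (D / w * heavy x)"
      using D w m heavy_ge by (intro mult_left_mono) auto
    also have "\<dots> \<le> m / 2 * (\<tau> x + p x)"
    proof (rule mult_left_mono)
      define A where "A = D / w * heavy x"
      have "2 * D / w * heavy x = 2 * A" by (simp add: A_def)
      then show "D / w * heavy x \<le> \<tau> x + p x"
        using \<tau>'_le[OF x] unfolding p_def A_def[symmetric] by simp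
    qed (use m in auto)
    also have "\<dots> \<le> F x + m / 2 * p x"
      using \<tau>_le[OF x] by (simp add: distrib_left)
    finally show "m / 2 * (D / w * (1 / (2 * pi\<^sup>2))) / (1 + x\<^sup>2) \<le> F x + m / 2 * p x" .
  qed
qed

lemma self_dual_strict_improvement:
  assumes f: "fourier_pair f f" and f0: "f 0 \<le> 0" and \<rho>: "\<rho> > 0" and \<sigma>: "\<sigma> > \<rho>"
    and nonneg: "\<And>x. \<bar>x\<bar> \<ge> \<rho> \<Longrightarrow> f x \<ge> 0"
    and unbounded: "\<And>R. \<exists>x\<ge>R. f x > 0"
  obtains G c where "fourier_pair G G" "G 0 < 0" "c > 0" "\<And>x. \<bar>x\<bar> \<ge> \<sigma> \<Longrightarrow> G x \<ge> c / (1 + x\<^sup>2)"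
proof -
  define \<eta> where "\<eta> = \<sigma> / \<rho> - 1"
  have \<eta>: "\<eta> > 0" "\<rho> * (1 + \<eta>) = \<sigma>" using \<rho> \<sigma> by (auto simp: \<eta>_def field_simps)
  \<comment> \<open>The choice of z below gives the interval [z / (1 + \<eta>), z] half-length w
    \<ge> W. As W > 1, this implies w^2 \<ge> w \<ge> W, which exceeds the threshold of
    \<open>self_dual_strictify\<close>.\<close>
  define W where "W = 1 + 12 * (1 + 1 / \<sigma>\<^sup>2)"
  have W: "W > 1" by (simp add: W_def add_pos_nonneg)
  obtain z where z: "z \<ge> max (\<rho> * (1 + \<eta>)\<^sup>2) (2 * W * (1 + \<eta>) / \<eta>)" "f z > 0"
    using unbounded by blast
  obtain F where F: "fourier_pair F F" "F 0 \<le> 0"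
    "\<And>x. \<bar>x\<bar> \<ge> \<sigma> \<Longrightarrow> F x \<ge> 0"
    "\<And>x. z / (1 + \<eta>) \<le> x \<Longrightarrow> x \<le> z \<Longrightarrow> F x > 0"
    using self_dual_spread_positivity[OF f f0 \<rho> \<eta>(1) nonneg, of z] z unfolding \<eta>(2) by auto
  define q where "q = z / (1 + \<eta>)"
  define w where "w = (z - q) / 2"
  define X where "X = (z + q) / 2"
  have "z > 0" using z(1) \<rho> \<eta>(1) by (auto intro: less_le_trans[rotated])
  then have "q > 0" using \<eta> by (simp add: q_def)
  have "w = z * \<eta> / (2 * (1 + \<eta>))" using \<eta>(1) by (simp add: w_def q_def field_simps)
  moreover have "2 * W * (1 + \<eta>) \<le> z * \<eta>" using z(1) \<eta>(1) by (simp add: pos_divide_le_eq)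
  ultimately have wW: "w \<ge> W" using \<eta>(1) by (simp add: pos_le_divide_eq mult_ac)
  have "w\<^sup>2 \<ge> w * 1" unfolding power2_eq_square using wW W by (intro mult_left_mono) auto
  then have w2: "w\<^sup>2 > 12 * (1 + 1 / \<sigma>\<^sup>2)" using wW by (simp add: W_def)
  show thesis
  proof (rule self_dual_strictify[OF F(1,2) _ F(3) _ _ w2, of X])
    show "0 < w" using wW W by simp
    show "w < X" unfolding w_def X_def using \<open>q > 0\<close> by simp
    show "F x > 0" if "X - w \<le> x" "x \<le> X + w" for x
      using that by (intro F(4)) (auto simp: X_def w_def q_def[symmetric] field_simps)
  qed (use that \<rho> \<sigma> in auto)
qed

section \<open>Passage from admissible to self-dual functions\<close>

lemma A_plus_fourier_pair:
  assumes "f \<in> A_plus"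
  shows "fourier_pair f (fourier_re f)"
  using assms by (intro fourier_pairI) (auto simp: A_plus_def fourier_re_def complex_eq_iff)

text \<open>Dilation by sqrt (s / t) moves both radii to their geometric mean; this is how the
  product of the radii enters. Then the function and its transform may be added without
  loss.\<close>

lemma A_plus_self_dual:
  assumes f: "f \<in> A_plus" and nz: "f \<noteq> (\<lambda>_. 0)" and s: "s > 0" "t > 0"
    and fs: "\<And>x. \<bar>x\<bar> \<ge> s \<Longrightarrow> f x \<ge> 0" and ft: "\<And>x. \<bar>x\<bar> \<ge> t \<Longrightarrow> fourier_re f x \<ge> 0"
  obtains F where "fourier_pair F F" "F 0 \<le> 0" "\<And>x. \<bar>x\<bar> \<ge> sqrt (s * t) \<Longrightarrow> F x \<ge> 0"
    "\<And>R. \<exists>x\<ge>R. F x > 0"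
proof -
  define l where "l = sqrt (s / t)"
  have l: "l > 0" "l * sqrt (s * t) = s" "sqrt (s * t) / l = t"
    using s by (auto simp: l_def real_sqrt_mult real_sqrt_divide)
  define p where "p = (\<lambda>x. f (l * x))"
  define q where "q = (\<lambda>x. fourier_re f (x / l) / l)"
  have pq: "fourier_pair p q" unfolding p_def q_def
    by (intro fourier_pair_dilate A_plus_fourier_pair f l)
  have p: "p x \<ge> 0" if "\<bar>x\<bar> \<ge> sqrt (s * t)" for x
  proof -
    have "l * sqrt (s * t) \<le> l * \<bar>x\<bar>" using that l(1) by (intro mult_left_mono) auto
    then show ?thesis unfolding p_def l(2) using l(1) by (intro fs) (simp add: abs_mult)
  qed
  have q: "q x \<ge> 0" if "\<bar>x\<bar> \<ge> sqrt (s * t)" for x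
  proof -
    have "sqrt (s * t) / l \<le> \<bar>x\<bar> / l" using that l(1) by (intro divide_right_mono) auto
    then have "fourier_re f (x / l) \<ge> 0" unfolding l(3) using l(1) by (intro ft) simp
    then show ?thesis unfolding q_def using l(1) by simp
  qed
  let ?F = "\<lambda>x. p x + q x"
  have F: "fourier_pair ?F ?F" by (rule fourier_pair_self_dual_add[OF pq])
  show thesis
  proof (rule that[of ?F])
    show "fourier_pair ?F ?F" by (rule F)
    show "p 0 + q 0 \<le> 0"
      using f l(1) by (auto simp: A_plus_def p_def q_def intro!: add_nonpos_nonpos divide_nonpos_pos)
    show "p x + q x \<ge> 0" if "\<bar>x\<bar> \<ge> sqrt (s * t)" for x
      using p q that by simp
    \<comment> \<open>Otherwise p + q vanishes near infinity and, being self-dual, everywhere. Then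
      p = - q with both nonnegative outside the radius, so both have compact support. This forces p
      = 0 and f = 0.\<close>
    show "\<exists>x\<ge>R. p x + q x > 0" for R
    proof (rule ccontr)
      assume "\<not> (\<exists>x\<ge>R. p x + q x > 0)"
      then have le: "p x + q x \<le> 0" if "x \<ge> R" for x using that by (meson not_le)
      have "?F x = 0" for x
      proof (rule fourier_pair_compact_supports[OF F, of "max R (sqrt (s * t))"])
        fix x assume "\<bar>x\<bar> \<ge> max R (sqrt (s * t))"
        then show "p x + q x = 0"
          using le[of "\<bar>x\<bar>"] p[of x] q[of x] fourier_pair_abs_arg[OF F, of x] by simp
        then show "p x + q x = 0" .
      qed
      then have "p x = - q x" for x by (simp add: eq_neg_iff_add_eq_0)
      then have 0: "p x = 0" "q x = 0" if "\<bar>x\<bar> \<ge> sqrt (s * t)" for x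
        using p[OF that] q[OF that] by (metis neg_0_le_iff_le order_antisym neg_equal_0_iff_equal)+
      have "p x = 0" for x by (rule fourier_pair_compact_supports[OF pq 0])
      then have "f (l * (x / l)) = 0" for x unfolding p_def .
      then show False using nz l(1) by (auto simp: fun_eq_iff)
    qed
  qed
qed

section \<open>Positivity of regularisations\<close>

context kernel
begin

text \<open>At least half of the kernel mass lies within t of x, where H is at least
  \<open>m\<close>. The negative part of H lives in |y| < \<rho>, where the kernel is at most
  \<kappa>, so it costs at most \<kappa> times the L1 norm.\<close>

lemma conv_ge:
  assumes H: "integrable lborel H" and d: "d > 0" and m: "m \<ge> 0"
    and nonneg: "\<And>y. \<bar>y\<bar> \<ge> \<rho> \<Longrightarrow> H y \<ge> 0"
    and near: "\<And>y. \<bar>x - y\<bar> < t \<Longrightarrow> H y \<ge> m"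
    and tail: "(\<integral>y. indicator {y. t \<le> \<bar>x - y\<bar>} y * (K ((x - y) / d) / d) \<partial>lborel) \<le> 1 / 2"
    and far: "\<And>y. \<bar>y\<bar> < \<rho> \<Longrightarrow> K ((x - y) / d) / d \<le> \<kappa>" and \<kappa>: "\<kappa> \<ge> 0"
  shows "(\<integral>y. H y * (K ((x - y) / d) / d) \<partial>lborel) \<ge> m / 2 - \<kappa> * (\<integral>y. \<bar>H y\<bar> \<partial>lborel)"
proof -
  let ?K = "\<lambda>y. K ((x - y) / d) / d"
  let ?i = "\<lambda>y. indicator {y. t \<le> \<bar>x - y\<bar>} y * ?K y"
  have K0: "?K y \<ge> 0" for y using kernel_axioms d by (simp add: kernel.nonneg)
  have Ki: "integrable lborel ?K" using d scaled_integrable by blast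
  have ii: "integrable lborel ?i"
    by (rule Bochner_Integration.integrable_bound[OF Ki]) (auto simp: indicator_def)
  have "m / 2 - \<kappa> * (\<integral>y. \<bar>H y\<bar> \<partial>lborel) \<le> m * 1 + (- m) * (\<integral>y. ?i y \<partial>lborel) + (- \<kappa>) * (\<integral>y. \<bar>H y\<bar> \<partial>lborel)"
    using mult_left_mono[OF tail m] by simp
  also have "\<dots> = (\<integral>y. m * ?K y + (- m) * ?i y + (- \<kappa>) * \<bar>H y\<bar> \<partial>lborel)"
    using integral_lincomb3[OF Ki ii integrable_abs[OF H]] scaled_integral[OF d, of x] by (simp only:)
  also have "\<dots> \<le> (\<integral>y. H y * ?K y \<partial>lborel)"
  proof (rule integral_mono)
    show "integrable lborel (\<lambda>y. m * ?K y + (- m) * ?i y + (- \<kappa>) * \<bar>H y\<bar>)"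
      using Ki ii H by (intro Bochner_Integration.integrable_add integrable_mult_right) auto
    show "integrable lborel (\<lambda>y. H y * ?K y)" by (rule mult_integrable[OF H d])
    fix y
    show "m * ?K y + (- m) * ?i y + (- \<kappa>) * \<bar>H y\<bar> \<le> H y * ?K y"
    proof (cases "t \<le> \<bar>x - y\<bar>")
      case True
      then have "?i y = ?K y" by simp
      moreover have "- \<kappa> * \<bar>H y\<bar> \<le> H y * ?K y"
      proof (cases "\<bar>y\<bar> < \<rho>")
        case True
        have "\<bar>H y\<bar> * ?K y \<le> \<bar>H y\<bar> * \<kappa>" using far[OF True] by (intro mult_left_mono) auto
        moreover have "- \<bar>H y\<bar> * ?K y \<le> H y * ?K y" using K0[of y] by (intro mult_right_mono) auto
        ultimately show ?thesis by (simp only: minus_mult_left[symmetric] mult.commute[of \<kappa>])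
      next
        case False
        have "- \<kappa> * \<bar>H y\<bar> \<le> 0" using \<kappa> by simp
        also have "0 \<le> H y * ?K y" using False nonneg[of y] K0[of y] by (intro mult_nonneg_nonneg) auto
        finally show ?thesis .
      qed
      ultimately show ?thesis by (simp only:)
    next
      case False
      then have "?i y = 0" by simp
      moreover have "m * ?K y \<le> H y * ?K y" using near[of y] False K0[of y] by (intro mult_right_mono) auto
      moreover have "- \<kappa> * \<bar>H y\<bar> \<le> 0" using \<kappa> by simp
      ultimately show ?thesis by (simp only: mult_zero_right)
    qed
  qed
  finally show ?thesis .
qed

text \<open>Gain and loss have the same order at infinity: half of c / (1 + (|x| + t)^2) against C d
  N / s^2, where s = |x| - \<rho> is the distance to the negative part. Hence one small d works for
  all x.\<close>

lemma conv_nonneg: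
  assumes H: "integrable lborel H" and c: "c > 0" and \<rho>: "\<rho> > 0" and t: "t > 0"
    and ge: "\<And>y. \<bar>y\<bar> \<ge> \<rho> \<Longrightarrow> H y \<ge> c / (1 + y\<^sup>2)"
  shows "\<forall>\<^sub>F d in at_right 0. \<forall>x. \<bar>x\<bar> \<ge> \<rho> + t \<longrightarrow> (\<integral>y. H y * (K ((x - y) / d) / d) \<partial>lborel) \<ge> 0"
proof -
  define N where "N = (\<integral>y. \<bar>H y\<bar> \<partial>lborel)"
  \<comment> \<open>Chosen so that |x| + t \<le> s r for every s \<ge> t; \<open>Q\<close> then
    bounds (1 + (|x| + t)^2) / s^2 uniformly.\<close>
  define r where "r = (\<rho> + 2 * t) / t"
  define Q where "Q = 1 / t\<^sup>2 + r\<^sup>2"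
  have Q: "Q > 0" using t by (simp add: Q_def add_pos_nonneg)
  have "((\<lambda>d. C * d * N) \<longlongrightarrow> C * 0 * N) (at_right 0)" by (intro tendsto_intros)
  then have "\<forall>\<^sub>F d in at_right 0. C * d * N < c / (2 * Q)"
    using c Q by (intro order_tendstoD) auto
  moreover have "\<forall>\<^sub>F d in at_right (0::real). d > 0"
    by (auto simp: eventually_at_filter)
  moreover have "\<forall>\<^sub>F d in at_right 0. \<forall>x. (\<integral>y. indicator {y. t \<le> \<bar>x - y\<bar>} y * (K ((x - y) / d) / d) \<partial>lborel) \<le> 1 / 2"
    using t by (intro tail) auto
  ultimately show ?thesis
  proof eventually_elim
    case (elim d)
    show ?case
    proof (intro allI impI)
      fix x :: real assume x: "\<bar>x\<bar> \<ge> \<rho> + t"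
      define s where "s = \<bar>x\<bar> - \<rho>"
      have s: "s \<ge> t" "s > 0" using x t by (auto simp: s_def)
      define m where "m = c / (1 + (\<bar>x\<bar> + t)\<^sup>2)"
      have "m / 2 - C * d / s\<^sup>2 * N \<le> (\<integral>y. H y * (K ((x - y) / d) / d) \<partial>lborel)"
        unfolding N_def
      proof (rule conv_ge[OF H \<open>d > 0\<close>, where t = t and \<rho> = \<rho>])
        show "m \<ge> 0" using c by (simp add: m_def)
        show "H y \<ge> 0" if "\<bar>y\<bar> \<ge> \<rho>" for y
          using ge[OF that] c by (auto intro: order_trans[rotated])
        show "m \<le> H y" if "\<bar>x - y\<bar> < t" for y
        proof -
          have y: "\<bar>y\<bar> \<ge> \<rho>" "\<bar>y\<bar> \<le> \<bar>\<bar>x\<bar> + t\<bar>" using that x \<rho> t by linarith+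
          then have "y\<^sup>2 \<le> (\<bar>x\<bar> + t)\<^sup>2" by (simp only: abs_le_square_iff)
          then have "m \<le> c / (1 + y\<^sup>2)" unfolding m_def using c by (intro divide_left_mono) (auto simp: add_pos_nonneg)
          also have "\<dots> \<le> H y" by (rule ge[OF y(1)])
          finally show ?thesis .
        qed
        show "(\<integral>y. indicator {y. t \<le> \<bar>x - y\<bar>} y * (K ((x - y) / d) / d) \<partial>lborel) \<le> 1 / 2" using elim by blast
        show "K ((x - y) / d) / d \<le> C * d / s\<^sup>2" if "\<bar>y\<bar> < \<rho>" for y
          using that s elim by (intro scaled_le) (auto simp: s_def)
        show "C * d / s\<^sup>2 \<ge> 0" using C_nonneg elim by simp
      qed
      moreover have "C * d / s\<^sup>2 * N \<le> m / 2"
      proof -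
        have "1 \<le> (s / t)\<^sup>2" using s t by (intro one_le_power) auto
        moreover have "(\<bar>x\<bar> + t)\<^sup>2 \<le> (s * r)\<^sup>2"
        proof (rule power_mono)
          have "\<bar>x\<bar> + t = s + (\<rho> + t) * 1" by (simp add: s_def)
          also have "\<dots> \<le> s + (\<rho> + t) * (s / t)"
            using s t \<rho> by (intro add_left_mono mult_left_mono) auto
          also have "\<dots> = s * r" using t by (simp add: r_def field_simps)
          finally show "\<bar>x\<bar> + t \<le> s * r" .
        qed (use t in auto)
        ultimately have "1 + (\<bar>x\<bar> + t)\<^sup>2 \<le> s\<^sup>2 * Q"
          unfolding Q_def by (simp add: distrib_left power_mult_distrib power_divide)
        then have m: "c / (s\<^sup>2 * Q) \<le> m" unfolding m_def
          using c s(2) Q by (intro divide_left_mono mult_pos_pos) (auto simp: add_pos_nonneg)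
        have "C * d / s\<^sup>2 * N = C * d * N / s\<^sup>2" by simp
        also have "\<dots> \<le> c / (2 * Q) / s\<^sup>2"
          using elim by (intro divide_right_mono) auto
        also have "\<dots> = c / (s\<^sup>2 * Q) / 2" by simp
        also have "\<dots> \<le> m / 2" using m by (intro divide_right_mono) auto
        finally show ?thesis .
      qed
      ultimately show "(\<integral>y. H y * (K ((x - y) / d) / d) \<partial>lborel) \<ge> 0" by linarith
    qed
  qed
qed

end

text \<open>Serves a function already damped by a Gaussian, whose lower bound is too weak against
  inverse-square tails. The tail exp (- pi (s / d)^2) of a narrow Gaussian is smaller still: b d^2 <
  1 makes a (|x| + t)^2 \<le> (s / d)^2.\<close>

lemma gaussian_conv_nonneg:
  assumes H: "integrable lborel H" and c: "c > 0" and \<rho>: "\<rho> > 0" and t: "t > 0" and a: "a > 0"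
    and ge: "\<And>y. \<bar>y\<bar> \<ge> \<rho> \<Longrightarrow> H y \<ge> c * exp (- a * y\<^sup>2)"
  shows "\<forall>\<^sub>F d in at_right 0. \<forall>x. \<bar>x\<bar> \<ge> \<rho> + t \<longrightarrow> (\<integral>y. H y * (exp (- pi * ((x - y) / d)\<^sup>2) / d) \<partial>lborel) \<ge> 0"
proof -
  interpret kernel "\<lambda>x. exp (- pi * x\<^sup>2)" 1 1 by (rule gaussian_kernel)
  define N where "N = (\<integral>y. \<bar>H y\<bar> \<partial>lborel)"
  have N: "N \<ge> 0" by (simp add: N_def)
  define r where "r = (\<rho> + 2 * t) / t"
  define b where "b = a * r\<^sup>2"
  have b: "b \<ge> 0" using a by (simp add: b_def)
  have "((\<lambda>d. N * d / t\<^sup>2) \<longlongrightarrow> N * 0 / t\<^sup>2) (at_right 0)" using t by (intro tendsto_intros) auto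
  then have "\<forall>\<^sub>F d in at_right 0. N * d / t\<^sup>2 < c / 2"
    using c by (intro order_tendstoD) auto
  moreover have "\<forall>\<^sub>F d in at_right 0. b * d\<^sup>2 < 1"
  proof -
    have "((\<lambda>d. b * d\<^sup>2) \<longlongrightarrow> b * 0\<^sup>2) (at_right 0)" by (intro tendsto_intros)
    then show ?thesis by (intro order_tendstoD) auto
  qed
  moreover have "\<forall>\<^sub>F d in at_right (0::real). d > 0"
    by (auto simp: eventually_at_filter)
  moreover have "\<forall>\<^sub>F d in at_right 0. \<forall>x. (\<integral>y. indicator {y. t \<le> \<bar>x - y\<bar>} y * (exp (- pi * ((x - y) / d)\<^sup>2) / d) \<partial>lborel) \<le> 1 / 2"
    using t by (intro tail) auto
  ultimately show ?thesis
  proof eventually_elim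
    case (elim d)
    show ?case
    proof (intro allI impI)
      fix x :: real assume x: "\<bar>x\<bar> \<ge> \<rho> + t"
      define s where "s = \<bar>x\<bar> - \<rho>"
      have s: "s \<ge> t" "s > 0" using x t by (auto simp: s_def)
      define m where "m = c * exp (- a * (\<bar>x\<bar> + t)\<^sup>2)"
      have "m / 2 - exp (- pi * (s / d)\<^sup>2) / d * N \<le> (\<integral>y. H y * (exp (- pi * ((x - y) / d)\<^sup>2) / d) \<partial>lborel)"
        unfolding N_def
      proof (rule conv_ge[OF H \<open>d > 0\<close>, where t = t and \<rho> = \<rho>])
        show "m \<ge> 0" using c by (simp add: m_def)
        show "H y \<ge> 0" if "\<bar>y\<bar> \<ge> \<rho>" for y
          using ge[OF that] c by (auto intro: order_trans[rotated])
        show "m \<le> H y" if "\<bar>x - y\<bar> < t" for y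
        proof -
          have y: "\<bar>y\<bar> \<ge> \<rho>" "\<bar>y\<bar> \<le> \<bar>\<bar>x\<bar> + t\<bar>" using that x \<rho> t by linarith+
          then have "y\<^sup>2 \<le> (\<bar>x\<bar> + t)\<^sup>2" by (simp only: abs_le_square_iff)
          then have "m \<le> c * exp (- a * y\<^sup>2)" unfolding m_def using c a by simp
          also have "\<dots> \<le> H y" by (rule ge[OF y(1)])
          finally show ?thesis .
        qed
        show "(\<integral>y. indicator {y. t \<le> \<bar>x - y\<bar>} y * (exp (- pi * ((x - y) / d)\<^sup>2) / d) \<partial>lborel) \<le> 1 / 2" using elim by blast
        show "exp (- pi * ((x - y) / d)\<^sup>2) / d \<le> exp (- pi * (s / d)\<^sup>2) / d" if "\<bar>y\<bar> < \<rho>" for y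
        proof -
          have "\<bar>s / d\<bar> \<le> \<bar>(x - y) / d\<bar>" using that s elim by (auto simp: s_def abs_divide intro!: divide_right_mono)
          then have "(s / d)\<^sup>2 \<le> ((x - y) / d)\<^sup>2" by (simp only: abs_le_square_iff)
          then show ?thesis using elim by (intro divide_right_mono) auto
        qed
        show "exp (- pi * (s / d)\<^sup>2) / d \<ge> 0" using elim by simp
      qed
      moreover have "exp (- pi * (s / d)\<^sup>2) / d * N \<le> m / 2"
      proof -
        have "(\<bar>x\<bar> + t)\<^sup>2 \<le> (s * r)\<^sup>2"
        proof (rule power_mono)
          have "\<bar>x\<bar> + t = s + (\<rho> + t) * 1" by (simp add: s_def)
          also have "\<dots> \<le> s + (\<rho> + t) * (s / t)"
            using s t \<rho> by (intro add_left_mono mult_left_mono) auto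
          also have "\<dots> = s * r" using t by (simp add: r_def field_simps)
          finally show "\<bar>x\<bar> + t \<le> s * r" .
        qed (use t in auto)
        then have "a * (\<bar>x\<bar> + t)\<^sup>2 \<le> b * s\<^sup>2"
          using a unfolding b_def by (simp add: power_mult_distrib mult_ac)
        also have "b * s\<^sup>2 = b * d\<^sup>2 * (s / d)\<^sup>2" using elim by (simp add: power_divide)
        also have "\<dots> \<le> 1 * (s / d)\<^sup>2" using elim by (intro mult_right_mono) auto
        finally have 1: "a * (\<bar>x\<bar> + t)\<^sup>2 \<le> (s / d)\<^sup>2" by simp
        define u where "u = (s / d)\<^sup>2"
        have u: "u > 0" using s elim by (simp add: u_def)
        \<comment> \<open>As pi > 2 there are two factors exp (- u) to spend. One is matched with
          the lower bound of H; the other is at most 1 / u = d^2 / s^2 and absorbs the normalisation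
          1 / d.\<close>
        have "exp (- pi * u) \<le> exp (- u) * (1 / u)"
        proof -
          have "2 * u \<le> pi * u" using u pi_gt3 by (intro mult_right_mono) auto
          then have "exp (- pi * u) \<le> exp (- u - u)" by simp
          also have "\<dots> = exp (- u) * exp (- u)" by (simp flip: exp_add)
          also have "\<dots> \<le> exp (- u) * (1 / u)"
          proof (rule mult_left_mono)
            have "u \<le> exp u" using exp_ge_add_one_self[of u] by linarith
            then show "exp (- u) \<le> 1 / u" using u by (simp add: exp_minus field_simps)
          qed simp
          finally show ?thesis .
        qed
        then have "exp (- pi * (s / d)\<^sup>2) / d * N \<le> exp (- u) * (1 / u) / d * N"
          unfolding u_def using elim N by (intro mult_right_mono divide_right_mono) auto
        also have "\<dots> = exp (- u) * (N * d / s\<^sup>2)"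
          using elim s by (simp add: u_def power_divide power2_eq_square)
        also have "\<dots> \<le> exp (- u) * (N * d / t\<^sup>2)"
          using elim s t N by (intro mult_left_mono divide_left_mono power_mono mult_nonneg_nonneg) auto
        also have "\<dots> \<le> exp (- u) * (c / 2)"
          using elim by (intro mult_left_mono) auto
        also have "\<dots> \<le> exp (- a * (\<bar>x\<bar> + t)\<^sup>2) * (c / 2)"
          using 1 c by (intro mult_right_mono) (auto simp: u_def)
        finally show ?thesis by (simp add: m_def mult.commute)
      qed
      ultimately show "(\<integral>y. H y * (exp (- pi * ((x - y) / d)\<^sup>2) / d) \<partial>lborel) \<ge> 0" by linarith
    qed
  qed
qed

lemma eventually_at_right_0D:
  assumes "\<forall>\<^sub>F d in at_right (0::real). P d"
  shows "\<exists>d>0. P d"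
  using eventually_happens'[OF trivial_limit_at_right_real eventually_conj[OF eventually_at_right_less assms]]
  by blast

section \<open>Sign radii and approximation\<close>

lemma sign_radius_le:
  assumes "r > 0" "\<And>x. \<bar>x\<bar> \<ge> r \<Longrightarrow> f x \<ge> 0"
  shows "sign_radius f \<le> r"
  unfolding sign_radius_def using assms
  by (intro cInf_lower) (auto intro!: bdd_belowI[of _ 0])

lemma sign_radius_set_nonempty:
  assumes "eventually_nonneg f"
  shows "{r. r > 0 \<and> (\<forall>x. \<bar>x\<bar> \<ge> r \<longrightarrow> f x \<ge> 0)} \<noteq> {}"
proof -
  obtain r where "\<forall>x. \<bar>x\<bar> \<ge> r \<longrightarrow> f x \<ge> 0"
    using assms unfolding eventually_nonneg_def by blast
  then have "max r 1 \<in> {r. r > 0 \<and> (\<forall>x. \<bar>x\<bar> \<ge> r \<longrightarrow> f x \<ge> 0)}" by auto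
  then show ?thesis by blast
qed

lemma sign_radius_nonneg:
  assumes "eventually_nonneg f"
  shows "0 \<le> sign_radius f"
  unfolding sign_radius_def
  by (rule cInf_greatest[OF sign_radius_set_nonempty[OF assms]]) auto

lemma nonneg_beyond_sign_radius:
  assumes "eventually_nonneg f" "sign_radius f < \<bar>x\<bar>"
  shows "f x \<ge> 0"
proof -
  obtain r where "\<forall>x. \<bar>x\<bar> \<ge> r \<longrightarrow> f x \<ge> 0" "r < \<bar>x\<bar>"
    using cInf_lessD[OF sign_radius_set_nonempty[OF assms(1)], of "\<bar>x\<bar>"] assms(2)
    unfolding sign_radius_def by auto
  then show ?thesis by simp
qed

lemma A_plus_memberI:
  assumes gh: "fourier_pair g h" and g0: "g 0 < 0" and h0: "h 0 \<le> 0" and r: "r > 0"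
    and g: "\<And>x. \<bar>x\<bar> \<ge> r \<Longrightarrow> g x \<ge> 0" and h: "\<And>x. \<bar>x\<bar> \<ge> r \<Longrightarrow> h x \<ge> 0"
  shows "g \<in> A_plus" "g \<noteq> (\<lambda>_. 0)" "sqrt (sign_radius g * sign_radius (fourier_re g)) \<le> r"
proof -
  have re: "fourier_re g = h"
    by (simp add: fourier_re_def fun_eq_iff fourier_pairD(5)[OF gh])
  have ev: "eventually_nonneg g" "eventually_nonneg h"
    using g h unfolding eventually_nonneg_def by blast+
  show "g \<in> A_plus"
    using fourier_pairD[OF gh] ev g0 h0 by (simp add: A_plus_def re)
  show "g \<noteq> (\<lambda>_. 0)" using g0 by auto
  have "sqrt (sign_radius g * sign_radius h) \<le> sqrt (r * r)"
    using sign_radius_le[of r g] sign_radius_le[of r h] g h r sign_radius_nonneg[OF ev(1)] sign_radius_nonneg[OF ev(2)]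
    by (intro real_sqrt_le_mono mult_mono) auto
  then show "sqrt (sign_radius g * sign_radius (fourier_re g)) \<le> r" using r by (simp add: re)
qed

lemma A_plus_strict_self_dual:
  assumes f: "f \<in> A_plus" and nz: "f \<noteq> (\<lambda>_. 0)"
    and v: "sqrt (sign_radius f * sign_radius (fourier_re f)) < v"
  obtains G c \<sigma> where "fourier_pair G G" "G 0 < 0" "c > 0" "0 < \<sigma>" "\<sigma> < v"
    "\<And>x. \<bar>x\<bar> \<ge> \<sigma> \<Longrightarrow> G x \<ge> c / (1 + x\<^sup>2)"
proof -
  have ev: "eventually_nonneg f" "eventually_nonneg (fourier_re f)"
    using f by (auto simp: A_plus_def)
  define a b where "a = sign_radius f" and "b = sign_radius (fourier_re f)"
  have ab: "a \<ge> 0" "b \<ge> 0" using sign_radius_nonneg ev by (auto simp: a_def b_def)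
  \<comment> \<open>The infima \<open>a\<close> and \<open>b\<close> are only known to be
    nonnegative and need not be attained. Adding a small e gives positive radii at which the sign
    conditions hold, with geometric mean still below v.\<close>
  have "((\<lambda>e. sqrt ((a + e) * (b + e))) \<longlongrightarrow> sqrt ((a + 0) * (b + 0))) (at_right 0)"
    by (intro tendsto_intros)
  then have "\<forall>\<^sub>F e in at_right 0. sqrt ((a + e) * (b + e)) < v"
    using v by (intro order_tendstoD) (auto simp: a_def b_def)
  then obtain e where e: "e > 0" "sqrt ((a + e) * (b + e)) < v"
    using eventually_at_right_0D by blast
  obtain F where F: "fourier_pair F F" "F 0 \<le> 0"
    "\<And>x. \<bar>x\<bar> \<ge> sqrt ((a + e) * (b + e)) \<Longrightarrow> F x \<ge> 0" "\<And>R. \<exists>x\<ge>R. F x > 0"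
  proof (rule A_plus_self_dual[OF f nz])
    show "a + e > 0" "b + e > 0" using ab e by auto
    show "f x \<ge> 0" if "\<bar>x\<bar> \<ge> a + e" for x
      using that e by (intro nonneg_beyond_sign_radius[OF ev(1)]) (simp add: a_def)
    show "fourier_re f x \<ge> 0" if "\<bar>x\<bar> \<ge> b + e" for x
      using that e by (intro nonneg_beyond_sign_radius[OF ev(2)]) (simp add: b_def)
  qed blast
  obtain \<sigma> where \<sigma>: "sqrt ((a + e) * (b + e)) < \<sigma>" "\<sigma> < v" using e(2) dense by blast
  have pos: "sqrt ((a + e) * (b + e)) > 0" using ab e by simp
  obtain G c where "fourier_pair G G" "G 0 < 0" "c > 0" "\<And>x. \<bar>x\<bar> \<ge> \<sigma> \<Longrightarrow> G x \<ge> c / (1 + x\<^sup>2)"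
    using self_dual_strict_improvement[OF F(1,2) pos \<sigma>(1) F(3,4)] by blast
  then show thesis using that \<sigma> pos by (meson less_trans)
qed

text \<open>Convolution with the Fejer kernel multiplies the transform by a tent, which is
  nonnegative with compact support. So signs survive on the transform side, and only the convolution
  itself needs \<open>conv_nonneg\<close>.\<close>

lemma A_plus_bandlimited_approx:
  assumes f: "f \<in> A_plus" "f \<noteq> (\<lambda>_. 0)"
    and v: "sqrt (sign_radius f * sign_radius (fourier_re f)) < v"
  shows "\<exists>g\<in>A_plus. g \<noteq> (\<lambda>_. 0) \<and> bandlimited g \<and> sqrt (sign_radius g * sign_radius (fourier_re g)) \<le> v"
proof -
  obtain G c \<sigma> where G: "fourier_pair G G" "G 0 < 0" "c > 0" "0 < \<sigma>" "\<sigma> < v"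
    "\<And>x. \<bar>x\<bar> \<ge> \<sigma> \<Longrightarrow> G x \<ge> c / (1 + x\<^sup>2)"
    using A_plus_strict_self_dual[OF f v] by blast
  have G_nonneg: "G x \<ge> 0" if "\<bar>x\<bar> \<ge> \<sigma>" for x
    using G(6)[OF that] G(3) by (auto intro: order_trans[rotated])
  let ?g = "\<lambda>d x. \<integral>y. G y * (fejer ((x - y) / d) / d) \<partial>lborel"
  have "\<forall>\<^sub>F d in at_right 0. \<forall>x. \<bar>x\<bar> \<ge> \<sigma> + (v - \<sigma>) \<longrightarrow> ?g d x \<ge> 0"
    by (rule kernel.conv_nonneg[OF fejer_kernel fourier_pairD(3)[OF G(1)] G(3,4) _ G(6)]) (use G in auto)
  moreover have "((\<lambda>d. ?g d 0) \<longlongrightarrow> G 0) (at_right 0)"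
    using fourier_pairD[OF G(1)]
    by (intro kernel.conv_tendsto[OF fejer_kernel]) (auto simp: continuous_on_eq_continuous_at)
  then have "\<forall>\<^sub>F d in at_right 0. ?g d 0 < 0" using G(2) by (rule order_tendstoD)
  ultimately have "\<forall>\<^sub>F d in at_right 0. (\<forall>x. \<bar>x\<bar> \<ge> v \<longrightarrow> ?g d x \<ge> 0) \<and> ?g d 0 < 0"
    by eventually_elim auto
  then obtain d where d: "\<And>x. \<bar>x\<bar> \<ge> v \<Longrightarrow> ?g d x \<ge> 0" "?g d 0 < 0" "d > 0"
    using eventually_at_right_0D by blast
  have pair: "fourier_pair (?g d) (\<lambda>\<xi>. G \<xi> * tent (d * \<xi>))"
    using fourier_pair_conv[OF G(1) fourier_pair_sym[OF fourier_pair_dilate[OF fourier_pair_tent d(3)]]] .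
  have "\<xi> \<in> {- (1 / d)..1 / d}" if "fourier (?g d) \<xi> \<noteq> 0" for \<xi>
  proof (rule ccontr)
    assume "\<xi> \<notin> {- (1 / d)..1 / d}"
    then have "\<bar>\<xi>\<bar> > 1 / d" by auto
    then have "\<bar>d * \<xi>\<bar> \<ge> 1" using d(3) by (simp add: abs_mult field_simps)
    then have "tent (d * \<xi>) = 0" by (simp add: tent_def)
    then show False using that fourier_pairD(5)[OF pair, of \<xi>] by simp
  qed
  then have "bounded {\<xi>. fourier (?g d) \<xi> \<noteq> 0}"
    by (intro bounded_subset[OF bounded_closed_interval[of "- (1 / d)" "1 / d"]]) auto
  then have "bandlimited (?g d)" unfolding bandlimited_def by simp
  moreover have "?g d \<in> A_plus \<and> ?g d \<noteq> (\<lambda>_. 0) \<and> sqrt (sign_radius (?g d) * sign_radius (fourier_re (?g d))) \<le> v"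
  proof (intro conjI)
    have "G 0 * tent (d * 0) \<le> 0" using G(2) by (simp add: tent_def)
    moreover have "v > 0" using G by simp
    moreover have "G x * tent (d * x) \<ge> 0" if "\<bar>x\<bar> \<ge> v" for x
      using G_nonneg[of x] G(5) that by (intro mult_nonneg_nonneg) (auto simp: tent_def)
    ultimately show "?g d \<in> A_plus" "?g d \<noteq> (\<lambda>_. 0)" "sqrt (sign_radius (?g d) * sign_radius (fourier_re (?g d))) \<le> v"
      using A_plus_memberI[OF pair d(2) _ _ d(1)] by blast+
  qed
  ultimately show ?thesis by blast
qed

section \<open>Schwartz functions from Gaussian regularisation\<close>

text \<open>Differentiation under the integral: by the mean value bound the difference quotients of
  m are at most B, so B |G| dominates along every sequence tending to x.\<close>

lemma DERIV_conv:
  assumes G: "integrable lborel G"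
    and m: "\<And>u. (m has_real_derivative m' u) (at u)" and cont: "continuous_on UNIV m'"
    and A: "\<And>u::real. \<bar>m u\<bar> \<le> A" and B: "\<And>u::real. \<bar>m' u\<bar> \<le> B"
  shows "((\<lambda>x. \<integral>y. G y * m (x - y) \<partial>lborel) has_real_derivative (\<integral>y. G y * m' (x - y) \<partial>lborel)) (at x)"
proof -
  have "continuous_on UNIV m"
    using m by (meson DERIV_isCont continuous_at_imp_continuous_on)
  then have [measurable]: "m \<in> borel_measurable borel" "m' \<in> borel_measurable borel" "G \<in> borel_measurable borel"
    using cont G by (auto intro: borel_measurable_continuous_onI)
  have int: "integrable lborel (\<lambda>y. G y * m (x - y))" for x
  proof (rule Bochner_Integration.integrable_bound)
    show "integrable lborel (\<lambda>y. A * G y)" using G by simp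
    show "AE y in lborel. norm (G y * m (x - y)) \<le> norm (A * G y)"
      by (intro AE_I2) (simp add: abs_mult mult.commute[of "\<bar>G _\<bar>"] mult_right_mono order_trans[OF A abs_ge_self])
  qed auto
  show ?thesis
    unfolding has_field_derivative_iff tendsto_at_iff_sequentially comp_def
  proof (intro allI impI)
    fix X :: "nat \<Rightarrow> real" assume X: "\<forall>i. X i \<in> UNIV - {x}" "X \<longlonglongrightarrow> x"
    have "(\<lambda>n. \<integral>y. G y * ((m (X n - y) - m (x - y)) / (X n - x)) \<partial>lborel) \<longlonglongrightarrow> (\<integral>y. G y * m' (x - y) \<partial>lborel)"
    proof (rule integral_dominated_convergence[where w = "\<lambda>y. B * \<bar>G y\<bar>"])
      show "AE y in lborel. (\<lambda>n. G y * ((m (X n - y) - m (x - y)) / (X n - x))) \<longlonglongrightarrow> G y * m' (x - y)"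
      proof (intro AE_I2 tendsto_mult tendsto_const)
        fix y
        have "((\<lambda>z. (m z - m (x - y)) / (z - (x - y))) \<longlongrightarrow> m' (x - y)) (at (x - y))"
          using m[of "x - y"] unfolding has_field_derivative_iff .
        moreover have "filterlim (\<lambda>n. X n - y) (at (x - y)) sequentially"
          unfolding filterlim_at using X by (auto intro!: tendsto_intros)
        ultimately have "(\<lambda>n. (m (X n - y) - m (x - y)) / ((X n - y) - (x - y))) \<longlonglongrightarrow> m' (x - y)"
          by (rule filterlim_compose)
        then show "(\<lambda>n. (m (X n - y) - m (x - y)) / (X n - x)) \<longlonglongrightarrow> m' (x - y)" by simp
      qed
      show "AE y in lborel. norm (G y * ((m (X n - y) - m (x - y)) / (X n - x))) \<le> B * \<bar>G y\<bar>" for n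
      proof (intro AE_I2)
        fix y
        have "norm (m (X n - y) - m (x - y)) \<le> B * norm ((X n - y) - (x - y))"
          using m B by (intro field_differentiable_bound[of UNIV m m']) auto
        then have "\<bar>m (X n - y) - m (x - y)\<bar> / \<bar>X n - x\<bar> \<le> B"
          using X by (auto simp: pos_divide_le_eq)
        then show "norm (G y * ((m (X n - y) - m (x - y)) / (X n - x))) \<le> B * \<bar>G y\<bar>"
          by (simp only: real_norm_def abs_mult abs_divide mult.commute[of B] mult_left_mono abs_ge_zero)
      qed
    qed (use G in auto)
    also have "(\<lambda>n. \<integral>y. G y * ((m (X n - y) - m (x - y)) / (X n - x)) \<partial>lborel)
      = (\<lambda>n. ((\<integral>y. G y * m (X n - y) \<partial>lborel) - (\<integral>y. G y * m (x - y) \<partial>lborel)) / (X n - x))"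
      using int by (simp add: right_diff_distrib flip: Bochner_Integration.integral_diff)
    finally show "(\<lambda>n. ((\<integral>y. G y * m (X n - y) \<partial>lborel) - (\<integral>y. G y * m (x - y) \<partial>lborel)) / (X n - x))
      \<longlonglongrightarrow> (\<integral>y. G y * m' (x - y) \<partial>lborel)" .
  qed
qed

section \<open>Gaussian moments and the functions they span\<close>

lemma power_times_gaussian_bounded:
  fixes a :: real
  assumes a: "a > 0"
  obtains B where "\<And>u::real. \<bar>u ^ j * exp (- a * u\<^sup>2)\<bar> \<le> B"
proof (cases "j = 0")
  case True
  then show ?thesis using a by (intro that[of 1]) simp
next
  case False
  \<comment> \<open>Splitting the exponent into j equal parts exhibits |u|^j exp (- a u^2) as the
    j-th power of |u| exp (- c u^2), so only the linear case is estimated.\<close>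
  define c where "c = a / real j"
  have c: "c > 0" "real j * c = a" using False a by (auto simp: c_def)
  define M where "M = max 1 (1 / c)"
  have 1: "\<bar>u\<bar> * exp (- c * u\<^sup>2) \<le> M" for u
  proof -
    have "\<bar>u\<bar> \<le> 1 + u\<^sup>2"
    proof (cases "\<bar>u\<bar> \<le> 1")
      case False
      then have "\<bar>u\<bar> * 1 \<le> \<bar>u\<bar> * \<bar>u\<bar>" by (intro mult_left_mono) auto
      then show ?thesis by (simp add: power2_eq_square)
    qed (simp add: add_increasing2)
    also have "\<dots> \<le> M * 1 + M * (c * u\<^sup>2)"
    proof (intro add_mono)
      have "1 / c * (c * u\<^sup>2) \<le> M * (c * u\<^sup>2)" using c by (intro mult_right_mono) (auto simp: M_def)
      then show "u\<^sup>2 \<le> M * (c * u\<^sup>2)" using c by simp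
    qed (simp add: M_def)
    also have "\<dots> = M * (1 + c * u\<^sup>2)" by (simp add: distrib_left)
    also have "\<dots> \<le> M * exp (c * u\<^sup>2)"
      by (intro mult_left_mono exp_ge_add_one_self) (simp add: M_def)
    finally show ?thesis by (simp add: exp_minus field_simps)
  qed
  show ?thesis
  proof (rule that[of "M ^ j"])
    fix u :: real
    have "\<bar>u ^ j * exp (- a * u\<^sup>2)\<bar> = (\<bar>u\<bar> * exp (- c * u\<^sup>2)) ^ j"
      by (simp add: abs_mult power_abs power_mult_distrib c(2)[symmetric] mult.assoc flip: exp_of_nat_mult)
    also have "\<dots> \<le> M ^ j" using 1 by (intro power_mono) auto
    finally show "\<bar>u ^ j * exp (- a * u\<^sup>2)\<bar> \<le> M ^ j" .
  qed
qed

text \<open>Convolution of G with u^j exp (- a u^2). For j = 0 it is a Gaussian average of G; higher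
  j appear in its derivatives.\<close>

definition gauss_moment :: "(real \<Rightarrow> real) \<Rightarrow> real \<Rightarrow> nat \<Rightarrow> real \<Rightarrow> real" where
  "gauss_moment G a j x = (\<integral>y. G y * ((x - y) ^ j * exp (- a * (x - y)\<^sup>2)) \<partial>lborel)"

lemma gauss_moment_integrable:
  fixes G :: "real \<Rightarrow> real"
  assumes G: "integrable lborel G" and a: "a > 0"
  shows "integrable lborel (\<lambda>y. G y * ((x - y) ^ j * exp (- a * (x - y)\<^sup>2)))"
proof -
  obtain B where B: "\<And>u::real. \<bar>u ^ j * exp (- a * u\<^sup>2)\<bar> \<le> B" using power_times_gaussian_bounded[OF a] by blast
  show ?thesis
  proof (rule Bochner_Integration.integrable_bound)
    show "integrable lborel (\<lambda>y. B * G y)" using G by simp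
    show "AE y in lborel. norm (G y * ((x - y) ^ j * exp (- a * (x - y)\<^sup>2))) \<le> norm (B * G y)"
    proof (intro AE_I2)
      fix y
      define k where "k = (x - y) ^ j * exp (- a * (x - y)\<^sup>2)"
      have "\<bar>k\<bar> \<le> \<bar>B\<bar>" using B[of "x - y"] unfolding k_def[symmetric] by linarith
      then show "norm (G y * ((x - y) ^ j * exp (- a * (x - y)\<^sup>2))) \<le> norm (B * G y)"
        unfolding k_def[symmetric] by (simp add: abs_mult mult.commute[of "\<bar>G y\<bar>"] mult_right_mono)
    qed
  qed (use G in auto)
qed

lemma gauss_moment_bounded:
  assumes G: "integrable lborel G" and a: "a > 0"
  obtains B where "\<And>x. \<bar>gauss_moment G a j x\<bar> \<le> B"
proof -
  obtain B where B: "\<And>u::real. \<bar>u ^ j * exp (- a * u\<^sup>2)\<bar> \<le> B" using power_times_gaussian_bounded[OF a] by blast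
  have le: "norm (gauss_moment G a j x) \<le> (\<integral>y. B * \<bar>G y\<bar> \<partial>lborel)" for x
    unfolding gauss_moment_def
  proof (rule Bochner_Integration.integral_norm_bound_integral[OF gauss_moment_integrable[OF G a]])
    show "integrable lborel (\<lambda>y. B * \<bar>G y\<bar>)" using G by simp
    fix y
    show "norm (G y * ((x - y) ^ j * exp (- a * (x - y)\<^sup>2))) \<le> B * \<bar>G y\<bar>"
      using mult_right_mono[OF B[of "x - y"], of "\<bar>G y\<bar>"] by (simp add: abs_mult mult_ac)
  qed
  show ?thesis by (rule that) (use le in \<open>simp only: real_norm_def\<close>)
qed

text \<open>Truncated subtraction is harmless: for j = 0 the term with \<open>j - 1\<close> carries
  the factor 0.\<close>

lemma gauss_moment_deriv:
  assumes G: "integrable lborel G" and a: "a > 0"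
  shows "(gauss_moment G a j has_real_derivative
     (real j * gauss_moment G a (j - 1) x - 2 * a * gauss_moment G a (Suc j) x)) (at x)"
proof -
  let ?m = "\<lambda>j u. u ^ j * exp (- a * u\<^sup>2)"
  obtain A where A: "\<And>u::real. \<bar>?m j u\<bar> \<le> A" using power_times_gaussian_bounded[OF a] by blast
  obtain B where B: "\<And>u::real. \<bar>?m (j - 1) u\<bar> \<le> B" using power_times_gaussian_bounded[OF a] by blast
  obtain C where C: "\<And>u::real. \<bar>?m (Suc j) u\<bar> \<le> C" using power_times_gaussian_bounded[OF a] by blast
  have "((\<lambda>x. \<integral>y. G y * ?m j (x - y) \<partial>lborel) has_real_derivative
     (\<integral>y. G y * (real j * ?m (j - 1) (x - y) - 2 * a * ?m (Suc j) (x - y)) \<partial>lborel)) (at x)"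
  proof (rule DERIV_conv[OF G _ _ A])
    show "((\<lambda>u. ?m j u) has_real_derivative (real j * ?m (j - 1) u - 2 * a * ?m (Suc j) u)) (at u)" for u
      by (auto intro!: derivative_eq_intros simp: algebra_simps)
    show "continuous_on UNIV (\<lambda>u. real j * ?m (j - 1) u - 2 * a * ?m (Suc j) u)"
      by (intro continuous_intros)
    fix u
    have "\<bar>real j * ?m (j - 1) u - 2 * a * ?m (Suc j) u\<bar> \<le> \<bar>real j * ?m (j - 1) u\<bar> + \<bar>2 * a * ?m (Suc j) u\<bar>"
      by (rule abs_triangle_ineq4)
    also have "\<dots> = real j * \<bar>?m (j - 1) u\<bar> + 2 * a * \<bar>?m (Suc j) u\<bar>"
      using a by (simp add: abs_mult)
    also have "\<dots> \<le> real j * B + 2 * a * C"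
      using a B C by (intro add_mono mult_left_mono) auto
    finally show "\<bar>real j * ?m (j - 1) u - 2 * a * ?m (Suc j) u\<bar> \<le> real j * B + 2 * a * C" .
  qed
  also have "(\<integral>y. G y * (real j * ?m (j - 1) (x - y) - 2 * a * ?m (Suc j) (x - y)) \<partial>lborel)
     = (\<integral>y. real j * (G y * ?m (j - 1) (x - y)) - 2 * a * (G y * ?m (Suc j) (x - y)) \<partial>lborel)"
    by (intro Bochner_Integration.integral_cong) (auto simp: algebra_simps)
  also have "\<dots> = real j * gauss_moment G a (j - 1) x - 2 * a * gauss_moment G a (Suc j) x"
    unfolding gauss_moment_def integral_mult_right_zero[symmetric]
    by (intro Bochner_Integration.integral_diff integrable_mult_right gauss_moment_integrable G a)
  finally show ?thesis unfolding gauss_moment_def .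
qed

text \<open>For positive a and b this is a class of bounded functions closed under differentiation
  and multiplication by powers of x, so Schwartz estimates follow without a formula for the n-th
  derivative.\<close>

inductive_set gauss_span :: "(real \<Rightarrow> real) \<Rightarrow> real \<Rightarrow> real \<Rightarrow> (real \<Rightarrow> real) set"
  for G :: "real \<Rightarrow> real" and a b :: real where
  base: "(\<lambda>x. x ^ i * gauss_moment G a j x * exp (- b * x\<^sup>2)) \<in> gauss_span G a b"
| add: "f \<in> gauss_span G a b \<Longrightarrow> g \<in> gauss_span G a b \<Longrightarrow> (\<lambda>x. f x + g x) \<in> gauss_span G a b"
| cmult: "f \<in> gauss_span G a b \<Longrightarrow> (\<lambda>x. c * f x) \<in> gauss_span G a b"

lemma gauss_span_mult_power:
  assumes "f \<in> gauss_span G a b"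
  shows "(\<lambda>x. x ^ m * f x) \<in> gauss_span G a b"
  using assms
proof induction
  case (base i j)
  have "(\<lambda>x. x ^ (m + i) * gauss_moment G a j x * exp (- b * x\<^sup>2)) \<in> gauss_span G a b"
    by (rule gauss_span.base)
  then show ?case by (simp add: power_add mult.assoc)
next
  case (add f g)
  then show ?case using gauss_span.add by (simp add: distrib_left)
next
  case (cmult f c)
  then show ?case using gauss_span.cmult[OF cmult.IH, of c] by (simp add: mult.left_commute)
qed

lemma gauss_span_bounded:
  assumes G: "integrable lborel G" and ab: "a > 0" "b > 0" and "f \<in> gauss_span G a b"
  shows "\<exists>B. \<forall>x. \<bar>f x\<bar> \<le> B"
  using assms(4)
proof induction
  case (base i j)
  obtain A where A: "\<And>u::real. \<bar>u ^ i * exp (- b * u\<^sup>2)\<bar> \<le> A" using power_times_gaussian_bounded[OF ab(2)] by blast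
  obtain B where B: "\<And>x. \<bar>gauss_moment G a j x\<bar> \<le> B" using gauss_moment_bounded[OF G ab(1)] by blast
  have "\<bar>x ^ i * gauss_moment G a j x * exp (- b * x\<^sup>2)\<bar> \<le> A * B" for x
  proof -
    have "\<bar>x ^ i * gauss_moment G a j x * exp (- b * x\<^sup>2)\<bar> = \<bar>x ^ i * exp (- b * x\<^sup>2)\<bar> * \<bar>gauss_moment G a j x\<bar>"
      by (simp add: abs_mult)
    also have "\<dots> \<le> A * B" using A B by (intro mult_mono) (auto intro: order_trans[OF abs_ge_zero])
    finally show ?thesis .
  qed
  then show ?case by blast
next
  case (add f g)
  then obtain A B where "\<And>x. \<bar>f x\<bar> \<le> A" "\<And>x. \<bar>g x\<bar> \<le> B" by blast
  then have "\<bar>f x + g x\<bar> \<le> A + B" for x by (meson abs_triangle_ineq add_mono order_trans)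
  then show ?case by blast
next
  case (cmult f c)
  then obtain A where "\<And>x. \<bar>f x\<bar> \<le> A" by blast
  then have "\<bar>c * f x\<bar> \<le> \<bar>c\<bar> * A" for x by (simp add: abs_mult mult_left_mono)
  then show ?case by blast
qed

lemma gauss_span_deriv:
  assumes G: "integrable lborel G" and a: "a > 0" and "f \<in> gauss_span G a b"
  shows "\<exists>f'\<in>gauss_span G a b. \<forall>x. (f has_real_derivative f' x) (at x)"
  using assms(3)
proof induction
  case (base i j)
  let ?t = "\<lambda>i j x. x ^ i * gauss_moment G a j x * exp (- b * x\<^sup>2)"
  let ?f' = "\<lambda>x. real i * ?t (i - 1) j x + (real j * ?t i (j - 1) x + ((- 2 * a) * ?t i (Suc j) x + (- 2 * b) * ?t (Suc i) j x))"
  have "?f' \<in> gauss_span G a b"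
    by (intro gauss_span.add gauss_span.cmult gauss_span.base)
  moreover have "(?t i j has_real_derivative ?f' x) (at x)" for x
    by (auto intro!: derivative_eq_intros gauss_moment_deriv[OF G a] simp: algebra_simps)
  ultimately show ?case by (intro bexI[of _ ?f']) auto
next
  case (add f g)
  then obtain f' g' where "f' \<in> gauss_span G a b" "g' \<in> gauss_span G a b"
    "\<forall>x. (f has_real_derivative f' x) (at x)" "\<forall>x. (g has_real_derivative g' x) (at x)" by blast
  then show ?case
    by (intro bexI[of _ "\<lambda>x. f' x + g' x"]) (auto intro: gauss_span.add DERIV_add)
next
  case (cmult f c)
  then obtain f' where "f' \<in> gauss_span G a b" "\<forall>x. (f has_real_derivative f' x) (at x)" by blast
  then show ?case
    by (intro bexI[of _ "\<lambda>x. c * f' x"]) (auto intro: gauss_span.cmult DERIV_cmult)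
qed

lemma gauss_span_schwartz:
  assumes G: "integrable lborel G" and ab: "a > 0" "b > 0" and f: "f \<in> gauss_span G a b"
  shows "schwartz f"
proof -
  have D: "deriv h \<in> gauss_span G a b \<and> (\<forall>x. (h has_real_derivative deriv h x) (at x))"
    if h: "h \<in> gauss_span G a b" for h
  proof -
    obtain h' where h': "h' \<in> gauss_span G a b" "\<forall>x. (h has_real_derivative h' x) (at x)"
      using gauss_span_deriv[OF G ab(1) h] by blast
    then have "deriv h = h'" by (auto intro!: ext DERIV_imp_deriv)
    with h' show ?thesis by simp
  qed
  have n: "(deriv ^^ n) f \<in> gauss_span G a b" for n
    by (induction n) (use f D in auto)
  show ?thesis unfolding schwartz_def
  proof (intro conjI allI)
    show "((deriv ^^ n) f has_real_derivative (deriv ^^ Suc n) f x) (at x)" for n x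
      using D[OF n] by simp
    show "bounded (range (\<lambda>x. x ^ m * (deriv ^^ n) f x))" for m n
      using gauss_span_bounded[OF G ab gauss_span_mult_power[OF n]]
      by (auto simp: bounded_iff)
  qed
qed

lemma fourier_pair_gaussian_dilate:
  assumes "d > 0"
  shows "fourier_pair (\<lambda>x. exp (- pi * (x / d)\<^sup>2) / d) (\<lambda>x. exp (- pi * (d * x)\<^sup>2))"
proof -
  have "fourier_pair (\<lambda>x. exp (- pi * x\<^sup>2)) (\<lambda>x. exp (- pi * x\<^sup>2))"
    using integrable_gaussian[of 1] fourier_gaussian[of 1]
    by (intro fourier_pairI continuous_intros) auto
  from fourier_pair_sym[OF fourier_pair_dilate[OF this assms]] show ?thesis .
qed

text \<open>Convolving with a Gaussian on one side multiplies by a positive Gaussian on the other,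
  which preserves signs. So each of the two rounds has one positivity to check: the first for G
  convolved, the second for the damped transform \<open>H\<close> convolved.\<close>

lemma A_plus_schwartz_approx:
  assumes f: "f \<in> A_plus" "f \<noteq> (\<lambda>_. 0)"
    and v: "sqrt (sign_radius f * sign_radius (fourier_re f)) < v"
  shows "\<exists>g\<in>A_plus. g \<noteq> (\<lambda>_. 0) \<and> schwartz g \<and> sqrt (sign_radius g * sign_radius (fourier_re g)) \<le> v"
proof -
  obtain G c \<sigma> where G: "fourier_pair G G" "G 0 < 0" "c > 0" "0 < \<sigma>" "\<sigma> < v"
    "\<And>x. \<bar>x\<bar> \<ge> \<sigma> \<Longrightarrow> G x \<ge> c / (1 + x\<^sup>2)"
    using A_plus_strict_self_dual[OF f v] by blast
  let ?conv = "\<lambda>H d x. \<integral>y. H y * (exp (- pi * ((x - y) / d)\<^sup>2) / d) \<partial>lborel :: real"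
  have neg: "\<forall>\<^sub>F d in at_right 0. ?conv H d 0 < 0" if "fourier_pair H h" "H 0 < 0" for H h
  proof (rule order_tendstoD(2))
    show "((\<lambda>d. ?conv H d 0) \<longlongrightarrow> H 0) (at_right 0)"
      using fourier_pairD[OF that(1)]
      by (intro kernel.conv_tendsto[OF gaussian_kernel]) (auto simp: continuous_on_eq_continuous_at)
  qed (rule that)
  have "\<forall>\<^sub>F d in at_right 0. \<forall>x. \<bar>x\<bar> \<ge> \<sigma> + (v - \<sigma>) \<longrightarrow> ?conv G d x \<ge> 0"
    by (rule kernel.conv_nonneg[OF gaussian_kernel fourier_pairD(3)[OF G(1)] G(3,4) _ G(6)]) (use G in auto)
  with neg[OF G(1,2)]
  have "\<forall>\<^sub>F d in at_right 0. (\<forall>x. \<bar>x\<bar> \<ge> v \<longrightarrow> ?conv G d x \<ge> 0) \<and> ?conv G d 0 < 0"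
    by eventually_elim auto
  then obtain e where e: "\<And>x. \<bar>x\<bar> \<ge> v \<Longrightarrow> ?conv G e x \<ge> 0" "?conv G e 0 < 0" "e > 0"
    using eventually_at_right_0D by blast
  define H where "H = (\<lambda>x. G x * exp (- pi * (e * x)\<^sup>2))"
  have pair1: "fourier_pair (?conv G e) H"
    unfolding H_def by (rule fourier_pair_conv[OF G(1) fourier_pair_gaussian_dilate[OF e(3)]])
  \<comment> \<open>The factor 1 / (1 + x^2) is weakened to exp (- x^2), so that the bound takes the
    purely Gaussian form required by \<open>gaussian_conv_nonneg\<close>.\<close>
  have H_ge: "H x \<ge> c * exp (- (1 + pi * e\<^sup>2) * x\<^sup>2)" if "\<bar>x\<bar> \<ge> \<sigma>" for x
  proof -
    have "exp (- (1 + pi * e\<^sup>2) * x\<^sup>2) = exp (- (x\<^sup>2)) * exp (- pi * (e * x)\<^sup>2)"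
      by (simp add: power_mult_distrib algebra_simps flip: exp_add)
    moreover have "exp (- (x\<^sup>2)) \<le> 1 / (1 + x\<^sup>2)"
      using exp_ge_add_one_self[of "x\<^sup>2"] by (simp add: exp_minus field_simps add_pos_nonneg)
    then have "c * exp (- (x\<^sup>2)) \<le> c * (1 / (1 + x\<^sup>2))" using G(3) by (intro mult_left_mono) auto
    then have "c * exp (- (x\<^sup>2)) \<le> G x" using G(6)[OF that] by simp
    then have "c * exp (- (x\<^sup>2)) * exp (- pi * (e * x)\<^sup>2) \<le> H x"
      unfolding H_def by (intro mult_right_mono) auto
    ultimately show ?thesis by simp
  qed
  have H0: "H 0 < 0" using G(2) by (simp add: H_def)
  have "\<forall>\<^sub>F d in at_right 0. \<forall>x. \<bar>x\<bar> \<ge> \<sigma> + (v - \<sigma>) \<longrightarrow> ?conv H d x \<ge> 0"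
    by (rule gaussian_conv_nonneg[OF fourier_pairD(4)[OF pair1] G(3,4) _ _ H_ge])
       (use G in \<open>auto simp: add_pos_nonneg\<close>)
  with neg[OF fourier_pair_sym[OF pair1] H0]
  have "\<forall>\<^sub>F d in at_right 0. (\<forall>x. \<bar>x\<bar> \<ge> v \<longrightarrow> ?conv H d x \<ge> 0) \<and> ?conv H d 0 < 0"
    by eventually_elim auto
  then obtain d where d: "\<And>x. \<bar>x\<bar> \<ge> v \<Longrightarrow> ?conv H d x \<ge> 0" "?conv H d 0 < 0" "d > 0"
    using eventually_at_right_0D by blast
  define S where "S = (\<lambda>x. ?conv G e x * exp (- pi * (d * x)\<^sup>2))"
  have pair2: "fourier_pair S (?conv H d)" unfolding S_def
    by (rule fourier_pair_sym[OF fourier_pair_conv[OF fourier_pair_sym[OF pair1] fourier_pair_gaussian_dilate[OF d(3)]]])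
  have "S = (\<lambda>x. 1 / e * (x ^ 0 * gauss_moment G (pi / e\<^sup>2) 0 x * exp (- (pi * d\<^sup>2) * x\<^sup>2)))"
    by (simp add: S_def gauss_moment_def power_mult_distrib power_divide fun_eq_iff)
  then have "S \<in> gauss_span G (pi / e\<^sup>2) (pi * d\<^sup>2)"
    using gauss_span.cmult[OF gauss_span.base] by metis
  then have "schwartz S"
    using d(3) e(3) by (intro gauss_span_schwartz[OF fourier_pairD(3)[OF G(1)]]) auto
  moreover have "S 0 < 0" using e(2) by (simp add: S_def)
  moreover have "v > 0" using G by simp
  moreover have "S x \<ge> 0" if "\<bar>x\<bar> \<ge> v" for x
    unfolding S_def by (intro mult_nonneg_nonneg e(1) that) simp
  ultimately show ?thesis
    using A_plus_memberI[OF pair2 _ less_imp_le[OF d(2)] _ _ d(1)] by blast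
qed

section \<open>Equality of the infima\<close>

lemma A_plus_const_eq:
  assumes approx: "\<And>f v. f \<in> A_plus \<Longrightarrow> f \<noteq> (\<lambda>_. 0) \<Longrightarrow>
      sqrt (sign_radius f * sign_radius (fourier_re f)) < v \<Longrightarrow>
      \<exists>g\<in>A_plus. g \<noteq> (\<lambda>_. 0) \<and> P g \<and> sqrt (sign_radius g * sign_radius (fourier_re g)) \<le> v"
  shows "A_plus_const P = A_plus_const (\<lambda>_. True)"
proof -
  let ?r = "\<lambda>f. sqrt (sign_radius f * sign_radius (fourier_re f))"
  let ?S = "\<lambda>P. {?r f | f. f \<in> A_plus \<and> f \<noteq> (\<lambda>_. 0) \<and> P f}"
  have bdd: "bdd_below (?S P)" for P
  proof (rule bdd_belowI[of _ 0])
    fix x assume "x \<in> ?S P"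
    then obtain f where "x = ?r f" "f \<in> A_plus" by blast
    then show "0 \<le> x" by (auto simp: A_plus_def sign_radius_nonneg)
  qed
  show ?thesis
  \<comment> \<open>If the class has no nonzero member, both sides are the infimum of the same empty
    set and agree whatever its default value; the comparison of infima needs nonempty sets.\<close>
  proof (cases "?S (\<lambda>_. True) = {}")
    case True
    then have "?S P = {}" by blast
    with True show ?thesis unfolding A_plus_const_def by (simp only:)
  next
    case False
    then obtain f where "f \<in> A_plus" "f \<noteq> (\<lambda>_. 0)" by blast
    from approx[OF this, of "?r f + 1"] have ne: "?S P \<noteq> {}" by auto
    show ?thesis unfolding A_plus_const_def
    proof (rule antisym)
      show "Inf (?S (\<lambda>_. True)) \<le> Inf (?S P)"
        by (rule cInf_superset_mono[OF ne bdd]) blast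
      show "Inf (?S P) \<le> Inf (?S (\<lambda>_. True))"
      proof (rule cInf_greatest[OF False])
        fix x assume "x \<in> ?S (\<lambda>_. True)"
        then obtain f where f: "x = ?r f" "f \<in> A_plus" "f \<noteq> (\<lambda>_. 0)" by blast
        show "Inf (?S P) \<le> x"
        proof (rule dense_ge)
          fix v assume "x < v"
          then obtain g where "g \<in> A_plus" "g \<noteq> (\<lambda>_. 0)" "P g" "?r g \<le> v"
            using approx[OF f(2,3)] f(1) by blast
          moreover from this have "Inf (?S P) \<le> ?r g" by (intro cInf_lower[OF _ bdd]) blast
          ultimately show "Inf (?S P) \<le> v" by linarith
        qed
      qed
    qed
  qed
qed

theorem theorem1:
  shows "A_plus_const (\<lambda>_. True) = A_plus_const bandlimited
       \<and> A_plus_const bandlimited = A_plus_const schwartz"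
  using A_plus_const_eq[OF A_plus_bandlimited_approx] A_plus_const_eq[OF A_plus_schwartz_approx]
  by simp

end
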